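(* Let $\alpha\in(0,1)\cup(1,\infty)$ and let $p_{X,Y}=p_Xp_{Y\mid X}$ be a joint distribution on finite alphabets $\mathcal X\times\mathcal Y$. Then $$I_\alpha^{\mathrm{LP}}(X;Y)=\begin{cases}\min_{\tilde q_{X,Y}}\min_{q_Y}F_\alpha^{\mathrm{LP}}(\tilde q_{X,Y},q_Y),&\alpha\in(0,1),\\[2pt]\max_{\tilde q_{X,Y}}\max_{r_{X\mid Y}}\tilde F_\alpha^{\mathrm{LP}}(\tilde q_{X,Y},r_{X\mid Y}),&\alpha\in(1,\infty),\end{cases}$$ where, writing $\tilde q_{X,Y}=\tilde q_X\tilde q_{Y\mid X}$, $$F_\alpha^{\mathrm{LP}}(\tilde q_{X,Y},q_Y):=\frac{\alpha}{1-\alpha}D(\tilde q_{X,Y}\|\tilde q_Xp_{Y\mid X})+D(\tilde q_X\tilde q_{Y\mid X}\|\tilde q_Xq_Y)+\frac{\alpha}{1-\alpha}D(\tilde q_X\|p_X),$$ $$\tilde F_\alpha^{\mathrm{LP}}(\tilde q_{X,Y},r_{X\mid Y}):=\frac{\alpha}{1-\alpha}D(\tilde q_{X,Y}\|\tilde q_Xp_{Y\mid X})+\mathbb E^{\tilde q_{X,Y}}\!\left[\log\frac{r_{X\mid Y}(X\mid Y)}{\tilde q_X(X)}\right]+\frac{\alpha}{1-\alpha}D(\tilde q_X\|p_X).$$ Moreover, for $\alpha\in(1,\infty)$, $$I_\alpha^{\mathrm{LP}}(X;Y)=\max_{r_{X\mid Y}}\frac{2\alpha-1}{\alpha-1}\log\sum_xp_X(x)^{\frac{\alpha}{2\alpha-1}}\Big(\sum_yp_{Y\mid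 X}(y\mid x)\,r_{X\mid Y}(x\mid y)^{1-\frac1\alpha}\Big)^{\frac{\alpha}{2\alpha-1}}.$$
   Context: All alphabets are finite and $\log$ is natural. $D(p\|q)$ is the Kullback–Leibler divergence. The Rényi divergence is $D_\alpha(p\|q):=\frac{1}{\alpha-1}\log\sum_zp(z)^\alpha q(z)^{1-\alpha}$, and the Lapidoth–Pfister mutual information of order $\alpha$ is $I_\alpha^{\mathrm{LP}}(X;Y):=\min_{q_X}\min_{q_Y}D_\alpha(p_Xp_{Y\mid X}\|q_Xq_Y)$ over distributions $q_X$ on $\mathcal X$ and $q_Y$ on $\mathcal Y$. Optimizations over $\tilde q_{X,Y}$ range over joint distributions on $\mathcal X\times\mathcal Y$ (with $X$-marginal $\tilde q_X$ and conditional $\tilde q_{Y\mid X}$), over $q_Y$ over distributions on $\mathcal Y$, and over $r_{X\mid Y}$ over all reverse channels (families $\{r_{X\mid Y}(\cdot\mid y)\}_{y}$ of distributions on $\mathcal X$). *)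

theory Defs
  imports Complex_Main "HOL-Library.Extended_Real"
begin

definition is_pmf :: "('a::finite \<Rightarrow> real) \<Rightarrow> bool" where
  "is_pmf p \<longleftrightarrow> (\<forall>a. 0 \<le> p a) \<and> (\<Sum>a\<in>UNIV. p a) = 1"

definition is_channel :: "('a \<Rightarrow> 'b::finite \<Rightarrow> real) \<Rightarrow> bool" where
  "is_channel W \<longleftrightarrow> (\<forall>a. is_pmf (W a))"

definition margX :: "('x \<times> 'y::finite \<Rightarrow> real) \<Rightarrow> 'x \<Rightarrow> real" where
  "margX q x = (\<Sum>y\<in>UNIV. q (x, y))"

definition KL :: "('a::finite \<Rightarrow> real) \<Rightarrow> ('a \<Rightarrow> real) \<Rightarrow> ereal" where
  "KL p q = (\<Sum>z\<in>UNIV. (if p z = 0 then 0 else if q z = 0 then \<infinity>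
                          else ereal (p z * ln (p z / q z))))"

text \<open>Renyi divergence of order alpha in (0,1) or (1,infinity), with the usual
  conventions (q(z)^(1-alpha) = +infinity when q(z)=0, alpha>1, p(z)>0;
  log 0 = -infinity).\<close>
definition renyi_sum :: "real \<Rightarrow> ('a::finite \<Rightarrow> real) \<Rightarrow> ('a \<Rightarrow> real) \<Rightarrow> ereal" where
  "renyi_sum \<alpha> p q = (\<Sum>z\<in>UNIV.
      (if p z = 0 then 0 else if q z = 0 then (if \<alpha> < 1 then 0 else \<infinity>)
       else ereal (p z powr \<alpha> * q z powr (1 - \<alpha>))))"

definition renyi :: "real \<Rightarrow> ('a::finite \<Rightarrow> real) \<Rightarrow> ('a \<Rightarrow> real) \<Rightarrow> ereal" where
  "renyi \<alpha> p q = (let S = renyi_sum \<alpha> p q in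
      if S = \<infinity> then (if 1 < \<alpha> then \<infinity> else -\<infinity>)
      else if S = 0 then (if 1 < \<alpha> then -\<infinity> else \<infinity>)
      else ereal (ln (real_of_ereal S) / (\<alpha> - 1)))"

text \<open>Lapidoth-Pfister mutual information of order alpha for p_X p_{Y|X}
  (min over q_X, q_Y; the minimum exists, written as Inf).\<close>
definition I_LP :: "real \<Rightarrow> ('x::finite \<Rightarrow> real) \<Rightarrow> ('x \<Rightarrow> 'y::finite \<Rightarrow> real) \<Rightarrow> ereal" where
  "I_LP \<alpha> pX W = (INF qXY \<in> {(qX, qY). is_pmf qX \<and> is_pmf qY}.
      renyi \<alpha> (\<lambda>(x, y). pX x * W x y) (\<lambda>(x, y). fst qXY x * snd qXY y))"

definition F_LP :: "real \<Rightarrow> ('x::finite \<Rightarrow> real) \<Rightarrow> ('x \<Rightarrow> 'y::finite \<Rightarrow> real)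
    \<Rightarrow> ('x \<times> 'y \<Rightarrow> real) \<Rightarrow> ('y \<Rightarrow> real) \<Rightarrow> ereal" where
  "F_LP \<alpha> pX W qt qY =
     ereal (\<alpha> / (1 - \<alpha>)) * KL qt (\<lambda>(x, y). margX qt x * W x y)
   + KL qt (\<lambda>(x, y). margX qt x * qY y)
   + ereal (\<alpha> / (1 - \<alpha>)) * KL (margX qt) pX"

text \<open>E^{q~}[log r(X|Y) / q~_X(X)], where r y x = r_{X|Y}(x|y).\<close>
definition exp_log_ratio :: "('x::finite \<times> 'y::finite \<Rightarrow> real) \<Rightarrow> ('y \<Rightarrow> 'x \<Rightarrow> real) \<Rightarrow> ereal" where
  "exp_log_ratio qt r = (\<Sum>xy\<in>UNIV. (case xy of (x, y) \<Rightarrow>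
      if qt (x, y) = 0 then 0 else if r y x = 0 then -\<infinity>
      else ereal (qt (x, y) * ln (r y x / margX qt x))))"

definition Ft_LP :: "real \<Rightarrow> ('x::finite \<Rightarrow> real) \<Rightarrow> ('x \<Rightarrow> 'y::finite \<Rightarrow> real)
    \<Rightarrow> ('x \<times> 'y \<Rightarrow> real) \<Rightarrow> ('y \<Rightarrow> 'x \<Rightarrow> real) \<Rightarrow> ereal" where
  "Ft_LP \<alpha> pX W qt r =
     ereal (\<alpha> / (1 - \<alpha>)) * KL qt (\<lambda>(x, y). margX qt x * W x y)
   + exp_log_ratio qt r
   + ereal (\<alpha> / (1 - \<alpha>)) * KL (margX qt) pX"

definition LP_closed :: "real \<Rightarrow> ('x::finite \<Rightarrow> real) \<Rightarrow> ('x \<Rightarrow> 'y::finite \<Rightarrow> real)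
    \<Rightarrow> ('y \<Rightarrow> 'x \<Rightarrow> real) \<Rightarrow> ereal" where
  "LP_closed \<alpha> pX W r =
     (let S = (\<Sum>x\<in>UNIV. pX x powr (\<alpha> / (2 * \<alpha> - 1)) *
                 (\<Sum>y\<in>UNIV. W x y * r y x powr (1 - 1 / \<alpha>)) powr (\<alpha> / (2 * \<alpha> - 1)))
      in if S = 0 then -\<infinity> else ereal ((2 * \<alpha> - 1) / (\<alpha> - 1) * ln S))"

definition is_min_value :: "'a set \<Rightarrow> ('a \<Rightarrow> ereal) \<Rightarrow> ereal \<Rightarrow> bool" where
  "is_min_value S f v \<longleftrightarrow> v \<in> f ` S \<and> (\<forall>s\<in>S. v \<le> f s)"

definition is_max_value :: "'a set \<Rightarrow> ('a \<Rightarrow> ereal) \<Rightarrow> ereal \<Rightarrow> bool" where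
  "is_max_value S f v \<longleftrightarrow> v \<in> f ` S \<and> (\<forall>s\<in>S. f s \<le> v)"

end

theory Submission
  imports Defs "HOL-Analysis.Analysis"
begin

text \<open>Write \<open>p = pX W\<close>, and let \<open>qX qY\<close> be an optimal product distribution in the definition of
  \<open>I_LP\<close>, obtained by compactness. The tilted distribution \<open>qt \<propto> p powr \<alpha> * (qX qY) powr (1 - \<alpha>)\<close> turns
  Jensen's inequality in the variational formula for the Renyi divergence into an equality.

  For \<open>\<alpha> < 1\<close>, the log-sum inequality gives \<open>D\<^sub>\<alpha>(p \<parallel> margX qt * qY) \<le> F_LP qt qY\<close> for all arguments, and
  at the tilted distribution \<open>F_LP\<close> is at most \<open>I_LP\<close>.

  For \<open>\<alpha> > 1\<close>, always \<open>Ft_LP qt r \<le> LP_closed r \<le> D\<^sub>\<alpha>(p \<parallel> qX qY)\<close>: the first step is the log-sum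
  inequality for each \<open>x\<close> and then over \<open>x\<close>, the second is Hoelder's inequality. Minimality of
  \<open>qX\<close> and \<open>qY\<close> forces the marginals of the tilted distribution to be \<open>qX\<close> and \<open>qY\<close>, so that with
  \<open>r\<close> its reverse channel all three quantities coincide.\<close>

section \<open>Inequalities for finite sums\<close>

lemma sum_UNIV_prod:
  fixes f :: "'a::finite \<times> 'b::finite \<Rightarrow> 'c::comm_monoid_add"
  shows "(\<Sum>z\<in>UNIV. f z) = (\<Sum>x\<in>UNIV. \<Sum>y\<in>UNIV. f (x, y))"
  by (simp add: sum.cartesian_product)

text \<open>Each term is bounded by the tangent line \<open>ln t \<le> t - 1\<close>. The form with
  an unnormalised \<open>f\<close> and the logarithm of its sum on the right is the one in which
  Jensen's inequality is applied below.\<close>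

lemma log_sum_inequality:
  fixes p f :: "'a \<Rightarrow> real"
  assumes "finite A" and p: "\<And>z. z \<in> A \<Longrightarrow> 0 \<le> p z" and f: "\<And>z. z \<in> A \<Longrightarrow> 0 \<le> f z"
    and pf: "\<And>z. z \<in> A \<Longrightarrow> p z \<noteq> 0 \<Longrightarrow> f z \<noteq> 0"
  shows "(\<Sum>z\<in>A. p z * ln (f z / p z)) \<le> sum p A * ln (sum f A / sum p A)"
proof (cases "sum p A = 0")
  case True
  then show ?thesis
    using p \<open>finite A\<close> by (simp add: sum_nonneg_eq_0_iff)
next
  case False
  let ?P = "sum p A" and ?F = "sum f A"
  have P: "?P > 0"
    using False sum_nonneg[of A p] p by fastforce
  obtain z where z: "z \<in> A" "p z \<noteq> 0"
    using False by (meson sum.neutral)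
  have F: "?F > 0"
    using pf[OF z] f z(1) \<open>finite A\<close> by (simp add: order_less_le sum_nonneg sum_nonneg_eq_0_iff) metis
  \<comment> \<open>The correction \<open>f z * ?P / ?F - p z\<close> sums to zero over
    \<open>A\<close>.\<close>
  have "p z * ln (f z / p z) \<le> p z * ln (?F / ?P) + (f z * ?P / ?F - p z)" if "z \<in> A" for z
  proof (cases "p z = 0")
    case True
    then show ?thesis using P F f[OF that] by simp
  next
    case False
    then have pos: "p z > 0" "f z > 0"
      using p[OF that] f[OF that] pf[OF that] by (auto simp: less_le)
    have "ln (f z / p z) - ln (?F / ?P) = ln (f z * ?P / (p z * ?F))"
      using pos P F by (simp add: ln_div ln_mult)
    also have "\<dots> \<le> f z * ?P / (p z * ?F) - 1"
      using pos P F by (intro ln_le_minus_one) simp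
    finally have "p z * (ln (f z / p z) - ln (?F / ?P)) \<le> p z * (f z * ?P / (p z * ?F) - 1)"
      using pos by (intro mult_left_mono) auto
    then show ?thesis
      using pos by (simp add: right_diff_distrib)
  qed
  then have "(\<Sum>z\<in>A. p z * ln (f z / p z)) \<le> (\<Sum>z\<in>A. p z * ln (?F / ?P) + (f z * ?P / ?F - p z))"
    by (rule sum_mono)
  also have "\<dots> = ?P * ln (?F / ?P)"
    using F by (simp add: sum.distrib sum_subtractf flip: sum_distrib_right sum_divide_distrib)
  finally show ?thesis .
qed

text \<open>The bound \<open>ln t \<le> t - 1\<close> is used at \<open>a / ?s\<close> and
  \<open>b / ?s\<close>, where the weighted right-hand sides cancel. Equality makes both bounds
  tight, which happens only at 1. The equality case later identifies the marginals of the tilted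
  distribution.\<close>

lemma weighted_AM_GM:
  fixes a b t :: real
  assumes "0 \<le> a" "0 \<le> b" "0 < t" "t < 1"
  shows weighted_AM_GM_le: "a powr t * b powr (1 - t) \<le> t * a + (1 - t) * b"
    and weighted_AM_GM_eqD: "a powr t * b powr (1 - t) = t * a + (1 - t) * b \<Longrightarrow> a = b"
proof -
  let ?s = "t * a + (1 - t) * b"
  have *: "a powr t * b powr (1 - t) \<le> ?s \<and> (a powr t * b powr (1 - t) = ?s \<longrightarrow> a = b)"
  proof (cases "a = 0 \<or> b = 0")
    case True
    then show ?thesis using assms by auto
  next
    case False
    then have pos: "a > 0" "b > 0" using assms by auto
    then have s: "?s > 0" using assms by (simp add: add_pos_pos)
    have la: "ln (a / ?s) \<le> a / ?s - 1" and lb: "ln (b / ?s) \<le> b / ?s - 1"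
      using pos s by (intro ln_le_minus_one divide_pos_pos; simp)+
    have id: "t * (a / ?s - 1) + (1 - t) * (b / ?s - 1) = 0"
      using s by (simp add: field_simps)
    have lneq: "ln (a powr t * b powr (1 - t)) - ln ?s = t * ln (a / ?s) + (1 - t) * ln (b / ?s)"
      using pos s by (simp add: ln_mult ln_div algebra_simps)
    have ta: "t * ln (a / ?s) \<le> t * (a / ?s - 1)" and tb: "(1 - t) * ln (b / ?s) \<le> (1 - t) * (b / ?s - 1)"
      using la lb assms by (intro mult_left_mono; simp)+
    have "ln (a powr t * b powr (1 - t)) \<le> ln ?s"
      using lneq id ta tb by linarith
    then have le: "a powr t * b powr (1 - t) \<le> ?s"
      using pos s by (subst (asm) ln_le_cancel_iff) auto
    have "a = b" if eq: "a powr t * b powr (1 - t) = ?s"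
    proof -
      have "t * ln (a / ?s) + (1 - t) * ln (b / ?s) = 0"
        using lneq eq by simp
      then have "t * ln (a / ?s) = t * (a / ?s - 1)" "(1 - t) * ln (b / ?s) = (1 - t) * (b / ?s - 1)"
        using id ta tb by linarith+
      then have "ln (a / ?s) = a / ?s - 1" "ln (b / ?s) = b / ?s - 1"
        using assms by auto
      then have "a / ?s = 1" "b / ?s = 1"
        using pos s ln_eq_minus_one divide_pos_pos by blast+
      then show ?thesis using s by (metis divide_eq_1_iff)
    qed
    with le show ?thesis by simp
  qed
  show "a powr t * b powr (1 - t) \<le> ?s" "a powr t * b powr (1 - t) = ?s \<Longrightarrow> a = b"
    using * by auto
qed

text \<open>After both sums are normalised to one, this is the weighted AM-GM inequality term by
  term.\<close>

lemma Holder_sum_powr: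
  fixes a b :: "'a \<Rightarrow> real"
  assumes "finite A" and a: "\<And>z. z \<in> A \<Longrightarrow> 0 \<le> a z" and b: "\<And>z. z \<in> A \<Longrightarrow> 0 \<le> b z"
    and t: "0 < t" "t < 1"
  shows "(\<Sum>z\<in>A. a z powr t * b z powr (1 - t)) \<le> sum a A powr t * sum b A powr (1 - t)"
proof (cases "sum a A = 0 \<or> sum b A = 0")
  case True
  then have "a z = 0 \<or> b z = 0" if "z \<in> A" for z
    using that a b \<open>finite A\<close> by (auto simp: sum_nonneg_eq_0_iff)
  then have "(\<Sum>z\<in>A. a z powr t * b z powr (1 - t)) = 0"
    by (intro sum.neutral) (metis mult_eq_0_iff powr_0)
  then show ?thesis by simp
next
  case False
  let ?a = "sum a A" and ?b = "sum b A"
  have pos: "?a > 0" "?b > 0"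
    using False sum_nonneg[of A a] sum_nonneg[of A b] a b by fastforce+
  have "(\<Sum>z\<in>A. a z powr t * b z powr (1 - t))
      = ?a powr t * ?b powr (1 - t) * (\<Sum>z\<in>A. (a z / ?a) powr t * (b z / ?b) powr (1 - t))"
    unfolding sum_distrib_left
    by (intro sum.cong refl) (use pos a b in \<open>simp add: powr_divide\<close>)
  also have "\<dots> \<le> ?a powr t * ?b powr (1 - t) * (\<Sum>z\<in>A. t * (a z / ?a) + (1 - t) * (b z / ?b))"
    by (intro mult_left_mono sum_mono weighted_AM_GM_le) (use pos a b t in auto)
  also have "(\<Sum>z\<in>A. t * (a z / ?a) + (1 - t) * (b z / ?b)) = 1"
    using pos by (simp add: sum.distrib flip: sum_distrib_left sum_divide_distrib)
  finally show ?thesis by simp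
qed

section \<open>Probability mass functions\<close>

lemma is_pmfD:
  assumes "is_pmf p"
  shows is_pmf_nonneg: "0 \<le> p a" and is_pmf_sum: "(\<Sum>a\<in>UNIV. p a) = 1"
  using assms by (auto simp: is_pmf_def)

lemma is_pmf_normalize:
  assumes "\<And>z. 0 \<le> f z" and "sum f UNIV > 0"
  shows "is_pmf (\<lambda>z. f z / sum f UNIV)"
  using assms by (auto simp: is_pmf_def simp flip: sum_divide_distrib)

lemma is_pmf_uniform: "is_pmf (\<lambda>_::'a::finite. 1 / real CARD('a))"
  by (simp add: is_pmf_def)

lemma is_pmf_pos: 
  assumes "is_pmf p"
  obtains a where "p a > 0"
  using assms by (metis is_pmf_def less_eq_real_def sum.neutral zero_neq_one)

lemma is_pmf_prod:
  assumes "is_pmf p" "is_channel W"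
  shows "is_pmf (\<lambda>(x, y). p x * W x y)"
  using assms
  by (auto simp: is_pmf_def is_channel_def sum_UNIV_prod simp flip: sum_distrib_left)

lemma is_pmf_margX:
  assumes "is_pmf q"
  shows "is_pmf (margX q)"
  using assms by (auto simp: is_pmf_def margX_def sum_UNIV_prod intro!: sum_nonneg)

lemma margX_eq_0D:
  assumes "is_pmf q" "margX q x = 0"
  shows "q (x, y) = 0"
  using assms by (auto simp: is_pmf_def margX_def sum_nonneg_eq_0_iff)

text \<open>The simplex is a closed subset of the cube, which is compact in the product topology by
  Tychonoff's theorem.\<close>

lemma compact_is_pmf: "compact {p :: 'a::finite \<Rightarrow> real. is_pmf p}"
proof -
  have "compactin (product_topology (\<lambda>_. euclidean) UNIV) (PiE UNIV (\<lambda>_::'a. {0..1::real}))"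
    by (subst compactin_PiE) auto
  then have "compact (PiE UNIV (\<lambda>_::'a. {0..1::real}))"
    by (simp add: euclidean_product_topology)
  moreover have "closed ({p :: 'a \<Rightarrow> real. \<forall>a. 0 \<le> p a} \<inter> {p. (\<Sum>a\<in>UNIV. p a) = 1})"
    by (intro closed_Int closed_Collect_all closed_Collect_le closed_Collect_eq continuous_intros
        continuous_on_product_coordinates)
  moreover have "p a \<le> 1" if "\<forall>a. 0 \<le> p a" "sum p UNIV = 1" for p :: "'a \<Rightarrow> real" and a
    using member_le_sum[of a UNIV p] that by simp
  then have "{p. is_pmf p} = PiE UNIV (\<lambda>_::'a. {0..1::real})
      \<inter> ({p. \<forall>a. 0 \<le> p a} \<inter> {p. (\<Sum>a\<in>UNIV. p a) = 1})"
    by (auto simp: is_pmf_def PiE_def)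
  ultimately show ?thesis
    by (metis compact_Int_closed)
qed

section \<open>Finiteness of the divergences\<close>

lemma KL_eq:
  assumes "\<And>z. p z \<noteq> 0 \<Longrightarrow> q z \<noteq> 0"
  shows "KL p q = ereal (\<Sum>z\<in>UNIV. p z * ln (p z / q z))"
  unfolding KL_def sum_ereal[symmetric]
  by (intro sum.cong refl) (use assms in auto)

lemma KL_eq_PInf:
  assumes "p z \<noteq> 0" "q z = 0"
  shows "KL p q = \<infinity>"
  unfolding KL_def using assms by (subst sum_Pinfty) auto

lemma KL_cases:
  obtains "KL p q = \<infinity>" "\<exists>z. p z \<noteq> 0 \<and> q z = 0"
  | "\<And>z. p z \<noteq> 0 \<Longrightarrow> q z \<noteq> 0" "KL p q = ereal (\<Sum>z\<in>UNIV. p z * ln (p z / q z))"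
  using KL_eq KL_eq_PInf by metis

lemma exp_log_ratio_eq:
  assumes "\<And>x y. qt (x, y) \<noteq> 0 \<Longrightarrow> r y x \<noteq> 0"
  shows "exp_log_ratio qt r = ereal (\<Sum>x\<in>UNIV. \<Sum>y\<in>UNIV. qt (x, y) * ln (r y x / margX qt x))"
proof -
  have "exp_log_ratio qt r
      = ereal (\<Sum>z\<in>UNIV. case z of (x, y) \<Rightarrow> qt (x, y) * ln (r y x / margX qt x))"
    unfolding exp_log_ratio_def sum_ereal[symmetric]
    by (intro sum.cong refl) (use assms in auto)
  then show ?thesis by (simp add: sum_UNIV_prod)
qed

lemma exp_log_ratio_eq_MInf:
  assumes "qt (x, y) \<noteq> 0" "r y x = 0"
  shows "exp_log_ratio qt r = -\<infinity>"
proof -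
  let ?f = "\<lambda>z. case z of (x, y) \<Rightarrow>
      if qt (x, y) = 0 then 0 else if r y x = 0 then -\<infinity>
      else ereal (qt (x, y) * ln (r y x / margX qt x))"
  \<comment> \<open>In \<open>ereal\<close>, \<open>\<infinity>\<close> absorbs
    \<open>-\<infinity>\<close>, so the other summands must first be seen not to reach
    \<open>\<infinity>\<close>.\<close>
  have "sum ?f (UNIV - {(x, y)}) \<noteq> \<infinity>"
    by (subst sum_Pinfty) (auto split: if_splits)
  then have "?f (x, y) + sum ?f (UNIV - {(x, y)}) = -\<infinity>"
    using assms by simp
  then show ?thesis
    unfolding exp_log_ratio_def by (subst sum.remove[of UNIV "(x, y)"]) auto
qed

lemma margX_neq_0D:
  assumes "margX q x \<noteq> 0"
  obtains y where "q (x, y) \<noteq> 0"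
  using assms unfolding margX_def by (meson sum.neutral)

lemma margX_pos:
  assumes "is_pmf q" "q (x, y) \<noteq> 0"
  shows "margX q x > 0"
  using assms margX_eq_0D[OF assms(1)] is_pmf_nonneg[OF is_pmf_margX[OF assms(1)], of x]
  by (metis less_eq_real_def)

lemma sum_margX: "(\<Sum>x\<in>UNIV. margX q x * g x) = (\<Sum>x\<in>UNIV. \<Sum>y\<in>UNIV. q (x, y) * g x)"
  by (simp add: margX_def sum_distrib_right)

section \<open>Real expressions and infinite values of the two functionals\<close>

lemma KL_joint_eq:
  assumes qt: "is_pmf qt" and ac: "\<And>x y. qt (x, y) \<noteq> 0 \<Longrightarrow> V x y \<noteq> 0"
  shows "KL qt (\<lambda>(x, y). margX qt x * V x y)
    = ereal (\<Sum>x\<in>UNIV. \<Sum>y\<in>UNIV. qt (x, y) * ln (qt (x, y) / (margX qt x * V x y)))"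
proof -
  have "KL qt (\<lambda>(x, y). margX qt x * V x y)
    = ereal (\<Sum>z\<in>UNIV. qt z * ln (qt z / (case z of (x, y) \<Rightarrow> margX qt x * V x y)))"
    using ac margX_pos[OF qt] by (intro KL_eq) (fastforce split: prod.splits)
  then show ?thesis by (simp add: sum_UNIV_prod)
qed

lemma KL_margX_eq:
  assumes ac: "\<And>x y. qt (x, y) \<noteq> 0 \<Longrightarrow> pX x \<noteq> 0"
  shows "KL (margX qt) pX = ereal (\<Sum>x\<in>UNIV. \<Sum>y\<in>UNIV. qt (x, y) * ln (margX qt x / pX x))"
proof -
  have "KL (margX qt) pX = ereal (\<Sum>x\<in>UNIV. margX qt x * ln (margX qt x / pX x))"
    by (intro KL_eq) (meson ac margX_neq_0D)
  then show ?thesis by (simp only: sum_margX)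
qed

text \<open>The marginal of \<open>qt\<close> cancels between the first and third divergences, which
  carry the same coefficient; only the middle one leaves \<open>ln (margX qt x)\<close>.\<close>

lemma F_LP_eq:
  assumes qt: "is_pmf qt" and pX: "is_pmf pX" and W: "is_channel W" and qY: "is_pmf qY"
    and ac: "\<And>x y. qt (x, y) \<noteq> 0 \<Longrightarrow> W x y \<noteq> 0 \<and> pX x \<noteq> 0 \<and> qY y \<noteq> 0"
  shows "F_LP \<alpha> pX W qt qY = ereal (\<Sum>x\<in>UNIV. \<Sum>y\<in>UNIV. qt (x, y) *
    (\<alpha> / (1 - \<alpha>) * (ln (qt (x, y)) - ln (pX x) - ln (W x y))
      + ln (qt (x, y)) - ln (margX qt x) - ln (qY y)))"
proof -
  have "F_LP \<alpha> pX W qt qY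
    = ereal (\<alpha> / (1 - \<alpha>) * (\<Sum>x\<in>UNIV. \<Sum>y\<in>UNIV. qt (x, y) * ln (qt (x, y) / (margX qt x * W x y)))
      + (\<Sum>x\<in>UNIV. \<Sum>y\<in>UNIV. qt (x, y) * ln (qt (x, y) / (margX qt x * qY y)))
      + \<alpha> / (1 - \<alpha>) * (\<Sum>x\<in>UNIV. \<Sum>y\<in>UNIV. qt (x, y) * ln (margX qt x / pX x)))"
    unfolding F_LP_def using ac by (simp add: KL_joint_eq KL_margX_eq qt)
  also have "\<dots> = ereal (\<Sum>x\<in>UNIV. \<Sum>y\<in>UNIV.
      \<alpha> / (1 - \<alpha>) * (qt (x, y) * ln (qt (x, y) / (margX qt x * W x y)))
      + qt (x, y) * ln (qt (x, y) / (margX qt x * qY y))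
      + \<alpha> / (1 - \<alpha>) * (qt (x, y) * ln (margX qt x / pX x)))"
    by (simp only: sum_distrib_left sum.distrib)
  also have "\<dots> = ereal (\<Sum>x\<in>UNIV. \<Sum>y\<in>UNIV. qt (x, y) *
    (\<alpha> / (1 - \<alpha>) * (ln (qt (x, y)) - ln (pX x) - ln (W x y))
      + ln (qt (x, y)) - ln (margX qt x) - ln (qY y)))"
  proof (intro arg_cong[of _ _ ereal] sum.cong refl)
    fix x y
    show "\<alpha> / (1 - \<alpha>) * (qt (x, y) * ln (qt (x, y) / (margX qt x * W x y)))
      + qt (x, y) * ln (qt (x, y) / (margX qt x * qY y))
      + \<alpha> / (1 - \<alpha>) * (qt (x, y) * ln (margX qt x / pX x))
      = qt (x, y) * (\<alpha> / (1 - \<alpha>) * (ln (qt (x, y)) - ln (pX x) - ln (W x y))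
      + ln (qt (x, y)) - ln (margX qt x) - ln (qY y))"
    proof (cases "qt (x, y) = 0")
      case False
      then have "qt (x, y) > 0" "margX qt x > 0" "W x y > 0" "pX x > 0" "qY y > 0"
        using margX_pos[OF qt] ac[of x y] is_pmfD[OF qt] is_pmfD[OF pX] is_pmfD[OF qY] W
        by (auto simp: less_le is_channel_def is_pmf_def)
      \<comment> \<open>The coefficient is made opaque so that the simplifier does not clear its
        denominator.\<close>
      moreover define d where "d = \<alpha> / (1 - \<alpha>)"
      ultimately show ?thesis
        unfolding d_def[symmetric] by (simp add: ln_div ln_mult algebra_simps)
    qed simp
  qed
  finally show ?thesis .
qed

text \<open>The coefficient is positive here, so an infinite divergence stays
  \<open>\<infinity>\<close> and absorbs the other two summands.\<close>

lemma F_LP_eq_PInf: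
  assumes "0 < \<alpha>" "\<alpha> < 1" and qt: "is_pmf qt"
    and ac: "qt (x, y) \<noteq> 0" "W x y = 0 \<or> pX x = 0 \<or> qY y = 0"
  shows "F_LP \<alpha> pX W qt qY = \<infinity>"
proof -
  have d: "\<alpha> / (1 - \<alpha>) > 0" using assms by simp
  have m: "margX qt x \<noteq> 0"
    using margX_pos[OF qt ac(1)] by simp
  consider "W x y = 0" | "qY y = 0" | "pX x = 0" using ac by blast
  then show ?thesis
  proof cases
    case 1
    then have "KL qt (\<lambda>(x, y). margX qt x * W x y) = \<infinity>"
      using ac by (intro KL_eq_PInf[of _ "(x, y)"]) auto
    then show ?thesis using d assms(1,2) by (simp add: F_LP_def)
  next
    case 2
    then have "KL qt (\<lambda>(x, y). margX qt x * qY y) = \<infinity>"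
      using ac by (intro KL_eq_PInf[of _ "(x, y)"]) auto
    then show ?thesis by (simp add: F_LP_def)
  next
    case 3
    then have "KL (margX qt) pX = \<infinity>"
      using m by (intro KL_eq_PInf)
    then show ?thesis using d assms(1,2) by (simp add: F_LP_def)
  qed
qed

lemma Ft_LP_eq:
  assumes qt: "is_pmf qt" and pX: "is_pmf pX" and W: "is_channel W" and r: "is_channel r"
    and ac: "\<And>x y. qt (x, y) \<noteq> 0 \<Longrightarrow> W x y \<noteq> 0 \<and> pX x \<noteq> 0 \<and> r y x \<noteq> 0"
  shows "Ft_LP \<alpha> pX W qt r = ereal (\<Sum>x\<in>UNIV. \<Sum>y\<in>UNIV. qt (x, y) *
    (\<alpha> / (1 - \<alpha>) * (ln (qt (x, y)) - ln (pX x) - ln (W x y)) + ln (r y x) - ln (margX qt x)))"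
proof -
  have "Ft_LP \<alpha> pX W qt r
    = ereal (\<alpha> / (1 - \<alpha>) * (\<Sum>x\<in>UNIV. \<Sum>y\<in>UNIV. qt (x, y) * ln (qt (x, y) / (margX qt x * W x y)))
      + (\<Sum>x\<in>UNIV. \<Sum>y\<in>UNIV. qt (x, y) * ln (r y x / margX qt x))
      + \<alpha> / (1 - \<alpha>) * (\<Sum>x\<in>UNIV. \<Sum>y\<in>UNIV. qt (x, y) * ln (margX qt x / pX x)))"
    unfolding Ft_LP_def using ac by (simp add: KL_joint_eq KL_margX_eq exp_log_ratio_eq qt)
  also have "\<dots> = ereal (\<Sum>x\<in>UNIV. \<Sum>y\<in>UNIV.
      \<alpha> / (1 - \<alpha>) * (qt (x, y) * ln (qt (x, y) / (margX qt x * W x y)))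
      + qt (x, y) * ln (r y x / margX qt x)
      + \<alpha> / (1 - \<alpha>) * (qt (x, y) * ln (margX qt x / pX x)))"
    by (simp only: sum_distrib_left sum.distrib)
  also have "\<dots> = ereal (\<Sum>x\<in>UNIV. \<Sum>y\<in>UNIV. qt (x, y) *
    (\<alpha> / (1 - \<alpha>) * (ln (qt (x, y)) - ln (pX x) - ln (W x y)) + ln (r y x) - ln (margX qt x)))"
  proof (intro arg_cong[of _ _ ereal] sum.cong refl)
    fix x y
    show "\<alpha> / (1 - \<alpha>) * (qt (x, y) * ln (qt (x, y) / (margX qt x * W x y)))
      + qt (x, y) * ln (r y x / margX qt x)
      + \<alpha> / (1 - \<alpha>) * (qt (x, y) * ln (margX qt x / pX x))
      = qt (x, y) * (\<alpha> / (1 - \<alpha>) * (ln (qt (x, y)) - ln (pX x) - ln (W x y))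
        + ln (r y x) - ln (margX qt x))"
    proof (cases "qt (x, y) = 0")
      case False
      then have "qt (x, y) > 0" "margX qt x > 0" "W x y > 0" "pX x > 0" "r y x > 0"
        using margX_pos[OF qt] ac[of x y] is_pmfD[OF qt] is_pmfD[OF pX] r W
        by (auto simp: less_le is_channel_def is_pmf_def)
      moreover define d where "d = \<alpha> / (1 - \<alpha>)"
      ultimately show ?thesis
        unfolding d_def[symmetric] by (simp add: ln_div ln_mult algebra_simps)
    qed simp
  qed
  finally show ?thesis .
qed

text \<open>The coefficient is negative here, so an infinite divergence contributes
  \<open>-\<infinity>\<close>. This survives the addition because no summand can be
  \<open>\<infinity>\<close>.\<close>

lemma Ft_LP_eq_MInf:
  assumes "1 < \<alpha>" and qt: "is_pmf qt"
    and ac: "qt (x, y) \<noteq> 0" "W x y = 0 \<or> pX x = 0 \<or> r y x = 0"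
  shows "Ft_LP \<alpha> pX W qt r = -\<infinity>"
proof -
  have d: "\<alpha> / (1 - \<alpha>) < 0" using assms by (simp add: divide_pos_neg)
  have dKL: "ereal (\<alpha> / (1 - \<alpha>)) * KL p q \<noteq> \<infinity>" for p q :: "'c::finite \<Rightarrow> real"
    by (rule KL_cases[of p q]) (use d in auto)
  have E: "exp_log_ratio qt r \<noteq> \<infinity>"
    unfolding exp_log_ratio_def by (subst sum_Pinfty) (auto split: if_splits)
  have add3: "a + b + c = -\<infinity>"
    if "a \<noteq> \<infinity>" "b \<noteq> \<infinity>" "c \<noteq> \<infinity>" "a = -\<infinity> \<or> b = -\<infinity> \<or> c = -\<infinity>" for a b c :: ereal
    using that by (cases a; cases b; cases c) auto
  have m: "margX qt x \<noteq> 0"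
    using margX_pos[OF qt ac(1)] by simp
  consider "W x y = 0" | "r y x = 0" | "pX x = 0" using ac by blast
  then show ?thesis
  proof cases
    case 1
    then have "KL qt (\<lambda>(x, y). margX qt x * W x y) = \<infinity>"
      using ac by (intro KL_eq_PInf[of _ "(x, y)"]) auto
    then have "ereal (\<alpha> / (1 - \<alpha>)) * KL qt (\<lambda>(x, y). margX qt x * W x y) = -\<infinity>"
      using d assms(1) by simp
    then show ?thesis unfolding Ft_LP_def by (intro add3[OF dKL E dKL]) blast
  next
    case 2
    then have "exp_log_ratio qt r = -\<infinity>"
      using ac by (intro exp_log_ratio_eq_MInf)
    then show ?thesis unfolding Ft_LP_def by (intro add3[OF dKL E dKL]) blast
  next
    case 3
    then have "KL (margX qt) pX = \<infinity>"
      using m by (intro KL_eq_PInf)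
    then have "ereal (\<alpha> / (1 - \<alpha>)) * KL (margX qt) pX = -\<infinity>"
      using d assms(1) by simp
    then show ?thesis unfolding Ft_LP_def by (intro add3[OF dKL E dKL]) blast
  qed
qed

section \<open>The Renyi divergence as the logarithm of a real sum\<close>

lemma renyi_eq_lt1:
  assumes "\<alpha> < 1"
  shows "renyi \<alpha> p q = (let S = (\<Sum>z\<in>UNIV. p z powr \<alpha> * q z powr (1 - \<alpha>)) in
    if S = 0 then \<infinity> else ereal (ln S / (\<alpha> - 1)))"
proof -
  \<comment> \<open>As \<open>0 powr t = 0\<close>, the conventions for vanishing \<open>p z\<close>
    or \<open>q z\<close> are already built into \<open>powr\<close> when \<alpha> < 1.\<close>
  have "renyi_sum \<alpha> p q = ereal (\<Sum>z\<in>UNIV. p z powr \<alpha> * q z powr (1 - \<alpha>))"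
    unfolding renyi_sum_def sum_ereal[symmetric] by (intro sum.cong refl) (use assms in auto)
  then show ?thesis using assms by (simp add: renyi_def Let_def)
qed

lemma renyi_eq_gt1:
  assumes "1 < \<alpha>" and ac: "\<And>z. p z \<noteq> 0 \<Longrightarrow> q z \<noteq> 0"
  shows "renyi \<alpha> p q = (let S = (\<Sum>z\<in>UNIV. p z powr \<alpha> * q z powr (1 - \<alpha>)) in
    if S = 0 then -\<infinity> else ereal (ln S / (\<alpha> - 1)))"
proof -
  have "renyi_sum \<alpha> p q = ereal (\<Sum>z\<in>UNIV. p z powr \<alpha> * q z powr (1 - \<alpha>))"
    unfolding renyi_sum_def sum_ereal[symmetric] by (intro sum.cong refl) (use ac in auto)
  then show ?thesis using assms by (simp add: renyi_def Let_def)
qed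

lemma renyi_eq_PInf:
  assumes "1 < \<alpha>" "p z \<noteq> 0" "q z = 0"
  shows "renyi \<alpha> p q = \<infinity>"
proof -
  have "renyi_sum \<alpha> p q = \<infinity>"
    unfolding renyi_sum_def using assms by (subst sum_Pinfty) auto
  then show ?thesis using assms by (simp add: renyi_def)
qed

section \<open>Optimal product distributions\<close>

text \<open>The sum inside the logarithm of the Renyi divergence, kept real-valued for topological
  arguments. Since \<open>0 powr t = 0\<close>, for \<alpha> > 1 it reflects the divergence only
  when the product is nonzero on the support of \<open>p\<close>.\<close>

definition LP_sum :: "real \<Rightarrow> ('x::finite \<times> 'y::finite \<Rightarrow> real) \<Rightarrow> ('x \<Rightarrow> real) \<Rightarrow> ('y \<Rightarrow> real) \<Rightarrow> real" where
  "LP_sum \<alpha> p qX qY = (\<Sum>x\<in>UNIV. \<Sum>y\<in>UNIV. p (x, y) powr \<alpha> * (qX x * qY y) powr (1 - \<alpha>))"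

lemma LP_sum_nonneg: "0 \<le> LP_sum \<alpha> p qX qY"
  by (auto simp: LP_sum_def intro!: sum_nonneg)

text \<open>This symmetry transfers statements about the first factor to the second.\<close>

lemma LP_sum_swap: "LP_sum \<alpha> (\<lambda>(y, x). p (x, y)) qY qX = LP_sum \<alpha> p qX qY"
  unfolding LP_sum_def by (subst sum.swap) (simp add: mult.commute)

lemma LP_sum_ge_term:
  "p (x, y) powr \<alpha> * (qX x * qY y) powr (1 - \<alpha>) \<le> LP_sum \<alpha> p qX qY"
proof -
  have "p (x, y) powr \<alpha> * (qX x * qY y) powr (1 - \<alpha>)
    \<le> (\<Sum>y\<in>UNIV. p (x, y) powr \<alpha> * (qX x * qY y) powr (1 - \<alpha>))"
    by (rule member_le_sum[of y]) auto
  also have "\<dots> \<le> LP_sum \<alpha> p qX qY"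
    unfolding LP_sum_def
    by (rule member_le_sum[of x _ "\<lambda>x. \<Sum>y\<in>UNIV. p (x, y) powr \<alpha> * (qX x * qY y) powr (1 - \<alpha>)"])
      (auto intro!: sum_nonneg)
  finally show ?thesis .
qed

lemma LP_sum_pos:
  assumes "is_pmf p" and ac: "\<And>x y. p (x, y) \<noteq> 0 \<Longrightarrow> qX x \<noteq> 0 \<and> qY y \<noteq> 0"
  shows "0 < LP_sum \<alpha> p qX qY"
proof -
  obtain x y where "p (x, y) > 0"
    using is_pmf_pos[OF assms(1)] by (metis surj_pair)
  then have "0 < p (x, y) powr \<alpha> * (qX x * qY y) powr (1 - \<alpha>)"
    using ac[of x y] by simp
  then show ?thesis using LP_sum_ge_term[of p x y \<alpha> qX qY] by linarith
qed

text \<open>The function \<open>t powr (1 - \<alpha>)\<close> is continuous up to 0 only for a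
  positive exponent; for \<alpha> > 1 the product must stay away from 0 wherever \<open>p\<close>
  does not vanish.\<close>

lemma continuous_on_LP_sum:
  assumes "\<And>x y qX qY. p (x, y) \<noteq> 0 \<Longrightarrow> (qX, qY) \<in> K \<Longrightarrow>
    0 \<le> qX x * qY y \<and> (qX x * qY y = 0 \<longrightarrow> \<alpha> < 1)"
  shows "continuous_on K (\<lambda>q. LP_sum \<alpha> p (fst q) (snd q))"
  unfolding LP_sum_def
proof (intro continuous_on_sum)
  fix x y
  show "continuous_on K (\<lambda>q. p (x, y) powr \<alpha> * (fst q x * snd q y) powr (1 - \<alpha>))"
  proof (cases "p (x, y) = 0")
    case False
    have "continuous_on K (\<lambda>q. fst q x)" "continuous_on K (\<lambda>q. snd q y)"
      by (rule continuous_on_product_then_coordinatewise, intro continuous_intros)+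
    then show ?thesis
      using assms[OF False] by (intro continuous_intros continuous_on_powr') auto
  qed simp
qed

text \<open>The factor \<open>1 / (\<alpha> - 1)\<close> is negative, so minimising the divergence
  means maximising the sum, which is continuous on the whole compact set of pairs.\<close>

lemma LP_sum_attains_max:
  fixes p :: "'x::finite \<times> 'y::finite \<Rightarrow> real"
  assumes "\<alpha> < 1"
  obtains qX qY where "is_pmf qX" "is_pmf qY"
    "\<And>qX' qY'. is_pmf qX' \<Longrightarrow> is_pmf qY' \<Longrightarrow> LP_sum \<alpha> p qX' qY' \<le> LP_sum \<alpha> p qX qY"
proof -
  let ?K = "{qX :: 'x \<Rightarrow> real. is_pmf qX} \<times> {qY :: 'y \<Rightarrow> real. is_pmf qY}"
  have "compact ?K" by (intro compact_Times compact_is_pmf)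
  moreover have "(\<lambda>_. 1 / real CARD('x), \<lambda>_. 1 / real CARD('y)) \<in> ?K"
    by (simp add: is_pmf_uniform)
  then have "?K \<noteq> {}" by blast
  moreover have "continuous_on ?K (\<lambda>q. LP_sum \<alpha> p (fst q) (snd q))"
    using assms by (intro continuous_on_LP_sum) (auto simp: is_pmf_nonneg)
  ultimately obtain q where "q \<in> ?K" "\<forall>q'\<in>?K. LP_sum \<alpha> p (fst q') (snd q') \<le> LP_sum \<alpha> p (fst q) (snd q)"
    using continuous_attains_sup[of ?K "\<lambda>q. LP_sum \<alpha> p (fst q) (snd q)"] by blast
  then show thesis by (intro that[of "fst q" "snd q"]) auto
qed

text \<open>For \<open>\<alpha> > 1\<close> the sum blows up where \<open>qX x * qY y\<close> vanishes on the support of \<open>p\<close>, so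
  minimisers are sought in the compact set where every term is at most the value \<open>B\<close> at the uniform
  distributions.\<close>

lemma LP_sum_attains_min:
  fixes p :: "'x::finite \<times> 'y::finite \<Rightarrow> real"
  assumes \<alpha>: "1 < \<alpha>" and p: "is_pmf p"
  obtains qX qY where "is_pmf qX" "is_pmf qY"
    "\<And>x y. p (x, y) \<noteq> 0 \<Longrightarrow> qX x \<noteq> 0 \<and> qY y \<noteq> 0"
    "\<And>qX' qY'. is_pmf qX' \<Longrightarrow> is_pmf qY' \<Longrightarrow>
      (\<And>x y. p (x, y) \<noteq> 0 \<Longrightarrow> qX' x \<noteq> 0 \<and> qY' y \<noteq> 0) \<Longrightarrow> LP_sum \<alpha> p qX qY \<le> LP_sum \<alpha> p qX' qY'"
proof -
  let ?uX = "\<lambda>_::'x. 1 / real CARD('x)" and ?uY = "\<lambda>_::'y. 1 / real CARD('y)"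
  define B where "B = LP_sum \<alpha> p ?uX ?uY"
  have B: "B > 0"
    unfolding B_def by (rule LP_sum_pos[OF p]) auto
  \<comment> \<open>For nonzero \<open>p (x, y)\<close>, \<open>\<delta> x y\<close> solves
    \<open>p (x, y) powr \<alpha> * c powr (1 - \<alpha>) = B\<close> for \<open>c\<close>: a term
    is at most \<open>B\<close> only if the product is at least \<open>\<delta> x y\<close>.\<close>
  define \<delta> where "\<delta> x y = (p (x, y) powr \<alpha> / B) powr (1 / (\<alpha> - 1))" for x y
  have \<delta>_pos: "\<delta> x y > 0" if "p (x, y) \<noteq> 0" for x y
    using that B by (simp add: \<delta>_def)
  have \<delta>_le: "\<delta> x y \<le> c" if "p (x, y) powr \<alpha> * c powr (1 - \<alpha>) \<le> B" "c > 0" for x y c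
  proof -
    have "p (x, y) powr \<alpha> / B \<le> c powr (\<alpha> - 1)"
      using that B by (simp add: field_simps powr_diff)
    then have "\<delta> x y \<le> (c powr (\<alpha> - 1)) powr (1 / (\<alpha> - 1))"
      unfolding \<delta>_def using \<alpha> B by (intro powr_mono2) auto
    then show ?thesis using that \<alpha> by (simp add: powr_powr)
  qed
  let ?D = "{q :: ('x \<Rightarrow> real) \<times> ('y \<Rightarrow> real). \<forall>x y. \<delta> x y \<le> fst q x * snd q y}"
  let ?K = "({qX :: 'x \<Rightarrow> real. is_pmf qX} \<times> {qY :: 'y \<Rightarrow> real. is_pmf qY}) \<inter> ?D"
  have cont: "continuous_on UNIV (\<lambda>q :: ('x \<Rightarrow> real) \<times> ('y \<Rightarrow> real). fst q x)"
    "continuous_on UNIV (\<lambda>q :: ('x \<Rightarrow> real) \<times> ('y \<Rightarrow> real). snd q y)" for x y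
    by (rule continuous_on_product_then_coordinatewise, intro continuous_intros)+
  have "closed ?D"
    by (intro closed_Collect_all closed_Collect_le continuous_on_const continuous_on_mult cont)
  then have "compact ?K"
    using compact_Int_closed[OF compact_Times[OF compact_is_pmf compact_is_pmf]] by blast
  moreover have u: "(?uX, ?uY) \<in> ?K"
  proof -
    have "\<delta> x y \<le> ?uX x * ?uY y" for x y
      using LP_sum_ge_term[of p x y \<alpha> ?uX ?uY] by (intro \<delta>_le) (simp_all add: B_def)
    then show ?thesis by (simp add: is_pmf_uniform)
  qed
  moreover have "continuous_on ?K (\<lambda>q. LP_sum \<alpha> p (fst q) (snd q))"
  proof (rule continuous_on_LP_sum)
    fix x y qX qY assume "p (x, y) \<noteq> 0" "(qX, qY) \<in> ?K"
    then have "0 < \<delta> x y" "\<delta> x y \<le> qX x * qY y" using \<delta>_pos by auto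
    then show "0 \<le> qX x * qY y \<and> (qX x * qY y = 0 \<longrightarrow> \<alpha> < 1)" by linarith
  qed
  ultimately obtain q where q: "q \<in> ?K"
    and min: "\<And>q'. q' \<in> ?K \<Longrightarrow> LP_sum \<alpha> p (fst q) (snd q) \<le> LP_sum \<alpha> p (fst q') (snd q')"
    using continuous_attains_inf[of ?K "\<lambda>q. LP_sum \<alpha> p (fst q) (snd q)"] by blast
  show thesis
  proof (rule that[of "fst q" "snd q"])
    show "is_pmf (fst q)" "is_pmf (snd q)" using q by auto
    show "fst q x \<noteq> 0 \<and> snd q y \<noteq> 0" if "p (x, y) \<noteq> 0" for x y
      using q \<delta>_pos[OF that] by (auto dest!: spec[of _ x] spec[of _ y])
  next
    fix qX' qY' assume q': "is_pmf qX'" "is_pmf qY'"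
      and ac: "\<And>x y. p (x, y) \<noteq> 0 \<Longrightarrow> qX' x \<noteq> 0 \<and> qY' y \<noteq> 0"
    show "LP_sum \<alpha> p (fst q) (snd q) \<le> LP_sum \<alpha> p qX' qY'"
    proof (cases "LP_sum \<alpha> p qX' qY' \<le> B")
      \<comment> \<open>A competitor with value at most \<open>B\<close> has all its terms at most
        \<open>B\<close>, hence lies in \<open>?K\<close>.\<close>
      case True
      have "\<delta> x y \<le> qX' x * qY' y" for x y
      proof (cases "p (x, y) = 0")
        case True
        then show ?thesis using q' by (simp add: \<delta>_def is_pmf_nonneg)
      next
        case False
        then have "qX' x * qY' y > 0"
          using ac[of x y] q' by (simp add: is_pmf_nonneg less_le)
        then show ?thesis
          using LP_sum_ge_term[of p x y \<alpha> qX' qY'] True by (intro \<delta>_le) simp_all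
      qed
      then show ?thesis using min[of "(qX', qY')"] q' by simp
    next
      \<comment> \<open>A competitor above \<open>B\<close> loses to the uniform pair, which lies in
        \<open>?K\<close>.\<close>
      case False
      then show ?thesis using min[OF u] by (simp add: B_def)
    qed
  qed
qed

text \<open>Against the competitor \<open>q' \<propto> a powr (1 / \<alpha>)\<close>, minimality of \<open>q\<close> forces equality in the weighted
  AM-GM inequality between \<open>q\<close> and its tilting \<open>a * q powr (1 - \<alpha>) / A\<close>.\<close>

lemma weighted_powr_minimizer:
  fixes a q :: "'a::finite \<Rightarrow> real"
  assumes \<alpha>: "1 < \<alpha>" and a: "\<And>x. 0 \<le> a x" and q: "is_pmf q"
    and ac: "\<And>x. a x \<noteq> 0 \<Longrightarrow> q x \<noteq> 0" and A_pos: "0 < (\<Sum>x\<in>UNIV. a x * q x powr (1 - \<alpha>))"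
    and min: "\<And>q'. is_pmf q' \<Longrightarrow> (\<And>x. a x \<noteq> 0 \<Longrightarrow> q' x \<noteq> 0) \<Longrightarrow>
      (\<Sum>x\<in>UNIV. a x * q x powr (1 - \<alpha>)) \<le> (\<Sum>x\<in>UNIV. a x * q' x powr (1 - \<alpha>))"
  shows "a x * q x powr (1 - \<alpha>) = (\<Sum>x\<in>UNIV. a x * q x powr (1 - \<alpha>)) * q x"
proof -
  define A where "A = (\<Sum>x\<in>UNIV. a x * q x powr (1 - \<alpha>))"
  define Z where "Z = (\<Sum>x\<in>UNIV. a x powr (1 / \<alpha>))"
  define m where "m x = a x * q x powr (1 - \<alpha>) / A" for x
  have A: "A > 0" using A_pos by (simp add: A_def)
  then have "(\<Sum>x\<in>UNIV. a x * q x powr (1 - \<alpha>)) \<noteq> 0"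
    by (simp add: A_def)
  then obtain x0 where "a x0 * q x0 powr (1 - \<alpha>) \<noteq> 0"
    by (rule sum.not_neutral_contains_not_neutral)
  then have "0 < a x0 powr (1 / \<alpha>)" by simp
  also have "\<dots> \<le> Z" unfolding Z_def by (rule member_le_sum) auto
  finally have Z: "Z > 0" .
  have "is_pmf (\<lambda>x. a x powr (1 / \<alpha>) / Z)"
    unfolding Z_def by (rule is_pmf_normalize) (use Z in \<open>auto simp: Z_def\<close>)
  \<comment> \<open>The competitor is the minimiser given by the Lagrange condition; its value is
    \<open>Z powr \<alpha>\<close>.\<close>
  then have "A \<le> (\<Sum>x\<in>UNIV. a x * (a x powr (1 / \<alpha>) / Z) powr (1 - \<alpha>))"
    unfolding A_def by (rule min) (use Z in auto)
  also have "\<dots> = (\<Sum>x\<in>UNIV. a x powr (1 / \<alpha>) * Z powr (\<alpha> - 1))"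
  proof (rule sum.cong[OF refl])
    fix x
    show "a x * (a x powr (1 / \<alpha>) / Z) powr (1 - \<alpha>) = a x powr (1 / \<alpha>) * Z powr (\<alpha> - 1)"
    proof (cases "a x = 0")
      case False
      then have "a x > 0" using a[of x] by simp
      then have "a x * (a x powr (1 / \<alpha>) / Z) powr (1 - \<alpha>)
        = a x powr 1 * a x powr (1 / \<alpha> * (1 - \<alpha>)) / Z powr (1 - \<alpha>)"
        using Z by (simp add: powr_divide powr_powr)
      also have "\<dots> = a x powr (1 + 1 / \<alpha> * (1 - \<alpha>)) * Z powr (\<alpha> - 1)"
        using Z by (simp only: powr_add) (simp add: powr_diff)
      also have "1 + 1 / \<alpha> * (1 - \<alpha>) = 1 / \<alpha>" using \<alpha> by (simp add: field_simps)
      finally show ?thesis .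
    qed simp
  qed
  also have "\<dots> = Z * Z powr (\<alpha> - 1)"
    by (simp only: Z_def sum_distrib_right)
  also have "\<dots> = Z powr \<alpha>"
    using Z by (simp add: powr_diff)
  finally have "A powr (1 / \<alpha>) \<le> (Z powr \<alpha>) powr (1 / \<alpha>)"
    using A \<alpha> by (intro powr_mono2) auto
  then have ZA: "A powr (1 / \<alpha>) \<le> Z"
    using Z \<alpha> by (simp add: powr_powr)
  have m0: "0 \<le> m x" for x using a[of x] A by (simp add: m_def)
  have q0: "0 \<le> q x" for x using q by (rule is_pmf_nonneg)
  have le: "m x powr (1 / \<alpha>) * q x powr (1 - 1 / \<alpha>) \<le> 1 / \<alpha> * m x + (1 - 1 / \<alpha>) * q x" for x
    using m0 q0 \<alpha> by (intro weighted_AM_GM_le) auto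
  \<comment> \<open>The powers of \<open>q\<close> cancel in the geometric mean, whose sum is
    therefore \<open>Z / A powr (1 / \<alpha>)\<close>, at least 1 by \<open>ZA\<close>.\<close>
  have tilt: "m x powr (1 / \<alpha>) * q x powr (1 - 1 / \<alpha>) = a x powr (1 / \<alpha>) / A powr (1 / \<alpha>)" for x
  proof (cases "a x = 0")
    case False
    then have pos: "a x > 0" "q x > 0" using a[of x] q0[of x] ac[of x] by (auto simp: less_le)
    have "m x powr (1 / \<alpha>) * q x powr (1 - 1 / \<alpha>)
      = a x powr (1 / \<alpha>) / A powr (1 / \<alpha>) * (q x powr ((1 - \<alpha>) * (1 / \<alpha>)) * q x powr (1 - 1 / \<alpha>))"
      using pos A by (simp add: m_def powr_divide powr_mult powr_powr)
    also have "q x powr ((1 - \<alpha>) * (1 / \<alpha>)) * q x powr (1 - 1 / \<alpha>) = 1"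
      using pos \<alpha> by (simp add: field_simps flip: powr_add)
    finally show ?thesis by simp
  qed (simp add: m_def)
  \<comment> \<open>Both \<open>m\<close> and \<open>q\<close> have mass one, so the arithmetic
    means sum to 1. The termwise AM-GM inequalities must then all be equalities.\<close>
  have "sum m UNIV = 1"
    using A by (simp add: m_def A_def flip: sum_divide_distrib)
  moreover have "(\<Sum>x\<in>UNIV. 1 / \<alpha> * m x + (1 - 1 / \<alpha>) * q x) = 1 / \<alpha> * sum m UNIV + (1 - 1 / \<alpha>) * sum q UNIV"
    by (simp only: sum.distrib sum_distrib_left)
  ultimately have "(\<Sum>x\<in>UNIV. 1 / \<alpha> * m x + (1 - 1 / \<alpha>) * q x) = 1"
    using q by (simp add: is_pmf_sum)
  also have "1 \<le> (\<Sum>x\<in>UNIV. m x powr (1 / \<alpha>) * q x powr (1 - 1 / \<alpha>))"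
    using ZA A by (simp add: tilt Z_def flip: sum_divide_distrib)
  finally have "(\<Sum>x\<in>UNIV. 1 / \<alpha> * m x + (1 - 1 / \<alpha>) * q x)
      \<le> (\<Sum>x\<in>UNIV. m x powr (1 / \<alpha>) * q x powr (1 - 1 / \<alpha>))" .
  moreover have "(\<Sum>x\<in>UNIV. m x powr (1 / \<alpha>) * q x powr (1 - 1 / \<alpha>))
      \<le> (\<Sum>x\<in>UNIV. 1 / \<alpha> * m x + (1 - 1 / \<alpha>) * q x)"
    by (rule sum_mono) (rule le)
  ultimately have "(\<Sum>x\<in>UNIV. m x powr (1 / \<alpha>) * q x powr (1 - 1 / \<alpha>))
      = (\<Sum>x\<in>UNIV. 1 / \<alpha> * m x + (1 - 1 / \<alpha>) * q x)"
    by (rule antisym[rotated])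
  then have "m x powr (1 / \<alpha>) * q x powr (1 - 1 / \<alpha>) = 1 / \<alpha> * m x + (1 - 1 / \<alpha>) * q x"
    by (rule sum_mono_inv[OF _ le]) auto
  then have "m x = q x"
    using m0 q0 \<alpha> by (intro weighted_AM_GM_eqD[of "m x" "q x" "1 / \<alpha>"]) auto
  then have "a x * q x powr (1 - \<alpha>) = A * q x"
    using A by (simp add: m_def field_simps)
  then show ?thesis by (simp only: A_def)
qed

text \<open>With \<open>qY\<close> fixed, the sum has the form treated in
  \<open>weighted_powr_minimizer\<close>. Divided by \<open>LP_sum\<close>, the conclusion says that
  the tilted distribution has first marginal \<open>qX\<close>.\<close>

lemma LP_sum_minimizer_marginal:
  fixes p :: "'x::finite \<times> 'y::finite \<Rightarrow> real"
  assumes \<alpha>: "1 < \<alpha>" and p: "is_pmf p" and qX: "is_pmf qX" and qY: "is_pmf qY"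
    and ac: "\<And>x y. p (x, y) \<noteq> 0 \<Longrightarrow> qX x \<noteq> 0 \<and> qY y \<noteq> 0"
    and min: "\<And>qX'. is_pmf qX' \<Longrightarrow> (\<And>x y. p (x, y) \<noteq> 0 \<Longrightarrow> qX' x \<noteq> 0) \<Longrightarrow>
      LP_sum \<alpha> p qX qY \<le> LP_sum \<alpha> p qX' qY"
  shows "(\<Sum>y\<in>UNIV. p (x, y) powr \<alpha> * (qX x * qY y) powr (1 - \<alpha>)) = LP_sum \<alpha> p qX qY * qX x"
proof -
  define a where "a x = (\<Sum>y\<in>UNIV. p (x, y) powr \<alpha> * qY y powr (1 - \<alpha>))" for x
  have inner: "(\<Sum>y\<in>UNIV. p (x, y) powr \<alpha> * (q x * qY y) powr (1 - \<alpha>)) = a x * q x powr (1 - \<alpha>)"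
    if "is_pmf q" for q :: "'x \<Rightarrow> real" and x
    using that qY by (simp add: a_def sum_distrib_left sum_distrib_right powr_mult is_pmf_nonneg mult_ac)
  then have LP: "LP_sum \<alpha> p q qY = (\<Sum>x\<in>UNIV. a x * q x powr (1 - \<alpha>))" if "is_pmf q" for q
    using that by (simp add: LP_sum_def)
  have a0: "0 \<le> a x" for x by (auto simp: a_def intro!: sum_nonneg)
  have a_iff: "a x \<noteq> 0 \<longleftrightarrow> (\<exists>y. p (x, y) \<noteq> 0)" for x
    using ac by (auto simp: a_def sum_nonneg_eq_0_iff)
  have "a x * qX x powr (1 - \<alpha>) = (\<Sum>x\<in>UNIV. a x * qX x powr (1 - \<alpha>)) * qX x"
  proof (rule weighted_powr_minimizer[OF \<alpha> a0 qX])
    show "qX x \<noteq> 0" if "a x \<noteq> 0" for x using that a_iff ac by blast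
    show "0 < (\<Sum>x\<in>UNIV. a x * qX x powr (1 - \<alpha>))"
      using LP_sum_pos[OF p, of qX qY \<alpha>] ac LP[OF qX] by simp
    fix q' assume "is_pmf q'" "\<And>x. a x \<noteq> 0 \<Longrightarrow> q' x \<noteq> 0"
    then show "(\<Sum>x\<in>UNIV. a x * qX x powr (1 - \<alpha>)) \<le> (\<Sum>x\<in>UNIV. a x * q' x powr (1 - \<alpha>))"
      using min[of q'] LP[OF qX] LP[of q'] a_iff by auto
  qed
  then show ?thesis using inner[OF qX] LP[OF qX] by simp
qed

section \<open>Renyi divergence from product distributions and the infimum
  \<open>I_LP\<close>\<close>

lemma renyi_prod_eq_lt1:
  assumes "\<alpha> < 1"
  shows "renyi \<alpha> p (\<lambda>(x, y). qX x * qY y) =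
    (if LP_sum \<alpha> p qX qY = 0 then \<infinity> else ereal (ln (LP_sum \<alpha> p qX qY) / (\<alpha> - 1)))"
  using renyi_eq_lt1[OF assms, of p "\<lambda>(x, y). qX x * qY y"] by (simp add: LP_sum_def sum_UNIV_prod)

lemma renyi_prod_eq_gt1:
  assumes "1 < \<alpha>" "is_pmf p" "\<And>x y. p (x, y) \<noteq> 0 \<Longrightarrow> qX x \<noteq> 0 \<and> qY y \<noteq> 0"
  shows "renyi \<alpha> p (\<lambda>(x, y). qX x * qY y) = ereal (ln (LP_sum \<alpha> p qX qY) / (\<alpha> - 1))"
proof -
  have "renyi \<alpha> p (\<lambda>(x, y). qX x * qY y) =
    (let S = (\<Sum>z\<in>UNIV. p z powr \<alpha> * (case z of (x, y) \<Rightarrow> qX x * qY y) powr (1 - \<alpha>)) in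
      if S = 0 then -\<infinity> else ereal (ln S / (\<alpha> - 1)))"
    by (rule renyi_eq_gt1) (use assms in \<open>auto split: prod.splits\<close>)
  moreover have "0 < LP_sum \<alpha> p qX qY"
    by (rule LP_sum_pos) (use assms in auto)
  ultimately show ?thesis by (simp add: LP_sum_def sum_UNIV_prod)
qed

lemma I_LP_le:
  assumes "is_pmf qX" "is_pmf qY"
  shows "I_LP \<alpha> pX W \<le> renyi \<alpha> (\<lambda>(x, y). pX x * W x y) (\<lambda>(x, y). qX x * qY y)"
  unfolding I_LP_def by (rule INF_lower2[of "(qX, qY)"]) (use assms in auto)

lemma I_LP_greatest:
  assumes "\<And>qX qY. is_pmf qX \<Longrightarrow> is_pmf qY \<Longrightarrow>
    v \<le> renyi \<alpha> (\<lambda>(x, y). pX x * W x y) (\<lambda>(x, y). qX x * qY y)"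
  shows "v \<le> I_LP \<alpha> pX W"
  unfolding I_LP_def by (rule INF_greatest) (use assms in auto)

section \<open>Bounds between the functionals\<close>

text \<open>The log-sum inequality compares \<open>qt\<close> with the unnormalised tilted weights
  \<open>f\<close>, taking \<open>margX qt\<close> as the first factor; the left side is then
  \<open>- (1 - \<alpha>)\<close> times the functional.\<close>

lemma renyi_le_F_LP:
  assumes \<alpha>: "0 < \<alpha>" "\<alpha> < 1" and pX: "is_pmf pX" and W: "is_channel W"
    and qt: "is_pmf qt" and qY: "is_pmf qY"
  shows "renyi \<alpha> (\<lambda>(x, y). pX x * W x y) (\<lambda>(x, y). margX qt x * qY y) \<le> F_LP \<alpha> pX W qt qY"
proof (cases "\<exists>x y. qt (x, y) \<noteq> 0 \<and> (W x y = 0 \<or> pX x = 0 \<or> qY y = 0)")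
  case True
  then show ?thesis using F_LP_eq_PInf[OF \<alpha> qt] by fastforce
next
  case False
  let ?p = "\<lambda>(x, y). pX x * W x y"
  define f where "f z = (case z of (x, y) \<Rightarrow> ?p (x, y) powr \<alpha> * (margX qt x * qY y) powr (1 - \<alpha>))" for z
  define R where "R = (\<Sum>x\<in>UNIV. \<Sum>y\<in>UNIV. qt (x, y) *
    (\<alpha> / (1 - \<alpha>) * (ln (qt (x, y)) - ln (pX x) - ln (W x y))
      + ln (qt (x, y)) - ln (margX qt x) - ln (qY y)))"
  have F: "F_LP \<alpha> pX W qt qY = ereal R"
    unfolding R_def by (rule F_LP_eq) (use assms False in auto)
  have sumf: "sum f UNIV = LP_sum \<alpha> ?p (margX qt) qY"
    by (simp add: f_def LP_sum_def sum_UNIV_prod)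
  have pos: "qt (x, y) > 0 \<and> margX qt x > 0 \<and> W x y > 0 \<and> pX x > 0 \<and> qY y > 0" if "qt (x, y) \<noteq> 0" for x y
    using that margX_pos[OF qt that] False is_pmfD[OF qt] is_pmfD[OF pX] is_pmfD[OF qY] W
    by (auto simp: less_le is_channel_def is_pmf_def)
  have f: "0 \<le> f z" "qt z \<noteq> 0 \<Longrightarrow> f z \<noteq> 0" for z
    using pos by (auto simp: f_def split: prod.splits) fastforce+
  have "(\<Sum>z\<in>UNIV. qt z * ln (f z / qt z)) \<le> sum qt UNIV * ln (sum f UNIV / sum qt UNIV)"
    by (rule log_sum_inequality) (use f is_pmfD[OF qt] in auto)
  also have "\<dots> = ln (LP_sum \<alpha> ?p (margX qt) qY)"
    by (simp add: sumf is_pmf_sum[OF qt])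
  also have "(\<Sum>z\<in>UNIV. qt z * ln (f z / qt z)) = - ((1 - \<alpha>) * R)"
    unfolding R_def sum_UNIV_prod sum_distrib_left sum_negf[symmetric]
  proof (intro sum.cong refl)
    fix x y
    show "qt (x, y) * ln (f (x, y) / qt (x, y)) = - ((1 - \<alpha>) * (qt (x, y) *
      (\<alpha> / (1 - \<alpha>) * (ln (qt (x, y)) - ln (pX x) - ln (W x y))
        + ln (qt (x, y)) - ln (margX qt x) - ln (qY y))))"
    proof (cases "qt (x, y) = 0")
      case False
      have "ln (f (x, y) / qt (x, y)) = \<alpha> * (ln (pX x) + ln (W x y))
          + (1 - \<alpha>) * (ln (margX qt x) + ln (qY y)) - ln (qt (x, y))"
        using pos[OF False] by (simp add: f_def ln_div ln_mult)
      also have "\<dots> = - ((1 - \<alpha>) * (\<alpha> / (1 - \<alpha>) * (ln (qt (x, y)) - ln (pX x) - ln (W x y))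
        + ln (qt (x, y)) - ln (margX qt x) - ln (qY y)))"
        using \<alpha> by (simp add: field_simps)
      finally show ?thesis by (simp only: mult_ac mult_minus_right)
    qed simp
  qed
  finally have "- ((1 - \<alpha>) * R) \<le> ln (LP_sum \<alpha> ?p (margX qt) qY)" .
  then have "ln (LP_sum \<alpha> ?p (margX qt) qY) / (\<alpha> - 1) \<le> R"
    using \<alpha> by (simp add: field_simps)
  moreover have "LP_sum \<alpha> ?p (margX qt) qY \<noteq> 0"
  proof -
    obtain z where "qt z > 0" using is_pmf_pos[OF qt] .
    then have "0 < f z" using f[of z] by simp
    also have "\<dots> \<le> sum f UNIV" using f by (intro member_le_sum) auto
    finally show ?thesis by (simp add: sumf)
  qed
  ultimately show ?thesis
    using \<alpha> by (simp add: F renyi_prod_eq_lt1)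
qed

text \<open>The supremum over \<open>qt\<close> is bounded in two stages: first over the conditional
  of y given x, which produces \<open>T x\<close>, then over the marginal, which produces the sum of
  \<open>g\<close>.\<close>

lemma Ft_LP_le_LP_closed:
  assumes \<alpha>: "1 < \<alpha>" and pX: "is_pmf pX" and W: "is_channel W"
    and qt: "is_pmf qt" and r: "is_channel r"
  shows "Ft_LP \<alpha> pX W qt r \<le> LP_closed \<alpha> pX W r"
proof (cases "\<exists>x y. qt (x, y) \<noteq> 0 \<and> (W x y = 0 \<or> pX x = 0 \<or> r y x = 0)")
  case True
  then show ?thesis using Ft_LP_eq_MInf[OF \<alpha> qt] by fastforce
next
  case False
  \<comment> \<open>\<open>c\<close> is minus the coefficient of the divergences. The identity
    \<open>c * \<theta> = 1\<close> absorbs \<open>ln (r y x)\<close> into the inner logarithm, and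
    \<open>(c + 1) * \<beta> = c\<close> absorbs \<open>pX x * T x\<close> into the outer
    one.\<close>
  define c \<beta> \<theta> where "c = \<alpha> / (\<alpha> - 1)" and "\<beta> = \<alpha> / (2 * \<alpha> - 1)" and "\<theta> = 1 - 1 / \<alpha>"
  have c: "c > 0" "c * \<theta> = 1" "(c + 1) * \<beta> = c" "c + 1 = (2 * \<alpha> - 1) / (\<alpha> - 1)" "\<alpha> / (1 - \<alpha>) = - c"
    using \<alpha> by (auto simp: c_def \<beta>_def \<theta>_def divide_simps) (simp add: algebra_simps)
  define T where "T x = (\<Sum>y\<in>UNIV. W x y * r y x powr \<theta>)" for x
  define g where "g x = pX x powr \<beta> * T x powr \<beta>" for x
  define m where "m = margX qt"
  have W0: "0 \<le> W x y" and r0: "0 \<le> r y x" for x y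
    using W r by (auto simp: is_channel_def is_pmf_def)
  have pos: "qt (x, y) > 0 \<and> m x > 0 \<and> W x y > 0 \<and> pX x > 0 \<and> r y x > 0" if "qt (x, y) \<noteq> 0" for x y
    using that margX_pos[OF qt that] False is_pmfD[OF qt] is_pmfD[OF pX] W0 r0
    by (auto simp: less_le m_def)
  have pos_m: "m x > 0 \<and> pX x > 0 \<and> T x > 0" if "m x \<noteq> 0" for x
  proof -
    obtain y where y: "qt (x, y) \<noteq> 0" using margX_neq_0D \<open>m x \<noteq> 0\<close> unfolding m_def .
    have "0 < W x y * r y x powr \<theta>" using pos[OF y] by simp
    also have "\<dots> \<le> T x"
      unfolding T_def using W0 by (intro member_le_sum[of y _ "\<lambda>y. W x y * r y x powr \<theta>"]) auto
    finally show ?thesis using pos[OF y] by simp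
  qed
  have inner: "(\<Sum>y\<in>UNIV. qt (x, y) *
      (- c * (ln (qt (x, y)) - ln (pX x) - ln (W x y)) + ln (r y x) - ln (m x)))
    \<le> (c + 1) * (m x * ln (g x / m x))" for x
  proof (cases "m x = 0")
    case True
    then have "qt (x, y) = 0" for y using margX_eq_0D[OF qt] by (simp add: m_def)
    then show ?thesis using True by simp
  next
    case False
    have "(\<Sum>y\<in>UNIV. qt (x, y) *
        (- c * (ln (qt (x, y)) - ln (pX x) - ln (W x y)) + ln (r y x) - ln (m x)))
      = (\<Sum>y\<in>UNIV. c * (qt (x, y) * ln (W x y * r y x powr \<theta> / qt (x, y)))
          + qt (x, y) * (c * ln (pX x) - ln (m x)))"
    proof (intro sum.cong refl)
      fix y
      show "qt (x, y) * (- c * (ln (qt (x, y)) - ln (pX x) - ln (W x y)) + ln (r y x) - ln (m x))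
        = c * (qt (x, y) * ln (W x y * r y x powr \<theta> / qt (x, y))) + qt (x, y) * (c * ln (pX x) - ln (m x))"
      proof (cases "qt (x, y) = 0")
        case False
        have "c * ln (W x y * r y x powr \<theta> / qt (x, y)) = c * ln (W x y) + (c * \<theta>) * ln (r y x) - c * ln (qt (x, y))"
          using pos[OF False] by (simp add: ln_div ln_mult algebra_simps)
        then have *: "c * ln (W x y * r y x powr \<theta> / qt (x, y)) = c * ln (W x y) + ln (r y x) - c * ln (qt (x, y))"
          by (simp add: c)
        show ?thesis
          unfolding mult.left_commute[of c] * by (simp add: algebra_simps)
      qed simp
    qed
    also have "\<dots> = c * (\<Sum>y\<in>UNIV. qt (x, y) * ln (W x y * r y x powr \<theta> / qt (x, y)))
        + m x * (c * ln (pX x) - ln (m x))"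
      by (simp only: sum.distrib sum_distrib_left sum_distrib_right m_def margX_def)
    \<comment> \<open>First log-sum inequality, over y for fixed x.\<close>
    also have "\<dots> \<le> c * (m x * ln (T x / m x)) + m x * (c * ln (pX x) - ln (m x))"
    proof -
      have "(\<Sum>y\<in>UNIV. qt (x, y) * ln (W x y * r y x powr \<theta> / qt (x, y)))
        \<le> (\<Sum>y\<in>UNIV. qt (x, y)) * ln (T x / (\<Sum>y\<in>UNIV. qt (x, y)))"
        unfolding T_def by (rule log_sum_inequality) (use pos W0 is_pmfD[OF qt] in force)+
      then show ?thesis
        using c by (simp add: m_def margX_def)
    qed
    also have "\<dots> = m x * (c * (ln (pX x) + ln (T x)) - (c + 1) * ln (m x))"
      using pos_m[OF False] by (simp add: ln_div algebra_simps)
    also have "\<dots> = m x * ((c + 1) * \<beta> * (ln (pX x) + ln (T x)) - (c + 1) * ln (m x))"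
      by (simp only: c(3))
    also have "\<dots> = (c + 1) * (m x * ln (g x / m x))"
      using pos_m[OF False] by (simp add: g_def ln_div ln_mult algebra_simps)
    finally show ?thesis .
  qed
  have mpmf: "is_pmf m" unfolding m_def by (rule is_pmf_margX[OF qt])
  have g: "0 \<le> g x" "m x \<noteq> 0 \<Longrightarrow> g x \<noteq> 0" for x
    using pos_m[of x] by (auto simp: g_def)
  have S: "sum g UNIV > 0"
  proof -
    obtain x where "m x > 0" using is_pmf_pos[OF mpmf] .
    then have "0 < g x" using g[of x] by simp
    also have "\<dots> \<le> sum g UNIV" using g by (intro member_le_sum) auto
    finally show ?thesis .
  qed
  have "(\<Sum>x\<in>UNIV. \<Sum>y\<in>UNIV. qt (x, y) *
      (- c * (ln (qt (x, y)) - ln (pX x) - ln (W x y)) + ln (r y x) - ln (m x)))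
    \<le> (\<Sum>x\<in>UNIV. (c + 1) * (m x * ln (g x / m x)))"
    by (rule sum_mono) (rule inner)
  also have "\<dots> = (c + 1) * (\<Sum>x\<in>UNIV. m x * ln (g x / m x))"
    by (simp only: sum_distrib_left)
  \<comment> \<open>Second log-sum inequality, over x.\<close>
  also have "\<dots> \<le> (c + 1) * (sum m UNIV * ln (sum g UNIV / sum m UNIV))"
    by (intro mult_left_mono log_sum_inequality) (use g c is_pmfD[OF mpmf] in auto)
  also have "\<dots> = (2 * \<alpha> - 1) / (\<alpha> - 1) * ln (sum g UNIV)"
    by (simp add: is_pmf_sum[OF mpmf] c(4))
  finally have "Ft_LP \<alpha> pX W qt r \<le> ereal ((2 * \<alpha> - 1) / (\<alpha> - 1) * ln (sum g UNIV))"
    using False by (subst Ft_LP_eq) (use assms in \<open>auto simp: c(5) m_def\<close>)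
  also have "\<dots> = LP_closed \<alpha> pX W r"
    using S by (simp add: LP_closed_def Let_def g_def T_def \<beta>_def \<theta>_def)
  finally show ?thesis .
qed

text \<open>Hoelder's inequality over y splits \<open>pX x * T x\<close> into a power of the Renyi
  terms \<open>U x\<close> and a power of \<open>qX x * \<rho> x\<close>. Hoelder over x then
  isolates the total of \<open>U\<close>, and Cauchy-Schwarz bounds the remaining factor by
  1.\<close>

lemma LP_closed_le_renyi:
  assumes \<alpha>: "1 < \<alpha>" and pX: "is_pmf pX" and W: "is_channel W"
    and r: "is_channel r" and qX: "is_pmf qX" and qY: "is_pmf qY"
  shows "LP_closed \<alpha> pX W r \<le> renyi \<alpha> (\<lambda>(x, y). pX x * W x y) (\<lambda>(x, y). qX x * qY y)"
proof (cases "\<exists>x y. pX x * W x y \<noteq> 0 \<and> qX x * qY y = 0")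
  case True
  then obtain x y where "pX x * W x y \<noteq> 0" "qX x * qY y = 0" by blast
  then have "renyi \<alpha> (\<lambda>(x, y). pX x * W x y) (\<lambda>(x, y). qX x * qY y) = \<infinity>"
    by (intro renyi_eq_PInf[OF \<alpha>, of _ "(x, y)"]) auto
  then show ?thesis by simp
next
  case False
  let ?p = "\<lambda>(x, y). pX x * W x y"
  \<comment> \<open>After raising to the power \<open>\<beta>\<close>, \<open>U x\<close> has
    exponent \<open>s\<close> and \<open>qX x * \<rho> x\<close> has exponent
    \<open>(1 - s) / 2\<close>: conjugate exponents in which the second factor is a square
    root.\<close>
  define \<beta> \<theta> s where "\<beta> = \<alpha> / (2 * \<alpha> - 1)" and "\<theta> = 1 - 1 / \<alpha>" and "s = 1 / (2 * \<alpha> - 1)"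
  have \<beta>: "\<beta> > 0" "1 / \<alpha> * \<beta> = s" "\<theta> * \<beta> = 1 / 2 * (1 - s)" "0 < s" "s < 1"
    using \<alpha> by (auto simp: \<beta>_def \<theta>_def s_def divide_simps) (simp add: algebra_simps)
  define T where "T x = (\<Sum>y\<in>UNIV. W x y * r y x powr \<theta>)" for x
  define u where "u x y = (pX x * W x y) powr \<alpha> * (qX x * qY y) powr (1 - \<alpha>)" for x y
  define U where "U x = (\<Sum>y\<in>UNIV. u x y)" for x
  \<comment> \<open>The distribution on the first alphabet induced by \<open>qY\<close> through the
    reverse channel \<open>r\<close>.\<close>
  define \<rho> where "\<rho> x = (\<Sum>y\<in>UNIV. qY y * r y x)" for x
  have W0: "0 \<le> W x y" and r0: "0 \<le> r y x" and p0: "0 \<le> pX x" and qX0: "0 \<le> qX x" and qY0: "0 \<le> qY y" for x y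
    using W r pX qX qY by (auto simp: is_channel_def is_pmf_def)
  have u0: "0 \<le> u x y" for x y by (simp add: u_def)
  have U0: "0 \<le> U x" for x using u0 by (simp add: U_def sum_nonneg)
  have T0: "0 \<le> T x" for x using W0 by (simp add: T_def sum_nonneg)
  have \<rho>0: "0 \<le> \<rho> x" for x using qY0 r0 by (simp add: \<rho>_def sum_nonneg)
  have sumU: "sum U UNIV = LP_sum \<alpha> ?p qX qY" by (simp add: LP_sum_def U_def u_def)
  have "sum \<rho> UNIV = (\<Sum>y\<in>UNIV. \<Sum>x\<in>UNIV. qY y * r y x)"
    unfolding \<rho>_def by (rule sum.swap)
  also have "\<dots> = 1"
    using r qY by (simp add: is_channel_def is_pmf_def flip: sum_distrib_left)
  finally have sum\<rho>: "sum \<rho> UNIV = 1" .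
  have pT: "pX x * T x \<le> U x powr (1 / \<alpha>) * (qX x * \<rho> x) powr \<theta>" for x
  proof -
    have "pX x * (W x y * r y x powr \<theta>) \<le> u x y powr (1 / \<alpha>) * (qX x * (qY y * r y x)) powr (1 - 1 / \<alpha>)" for y
    proof (cases "pX x * W x y = 0")
      case True
      then have zero: "pX x * (W x y * r y x powr \<theta>) = 0" by auto
      show ?thesis unfolding zero by simp
    next
      case neq: False
      then have q: "qX x * qY y > 0" and p: "pX x * W x y > 0"
        using False qX0[of x] qY0[of y] p0[of x] W0[of x y] by (metis less_eq_real_def mult_nonneg_nonneg)+
      have "u x y powr (1 / \<alpha>) * (qX x * (qY y * r y x)) powr (1 - 1 / \<alpha>)
        = pX x * W x y * ((qX x * qY y) powr ((1 - \<alpha>) * (1 / \<alpha>)) * (qX x * qY y) powr (1 - 1 / \<alpha>)) * r y x powr \<theta>"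
        using q p r0[of y x] \<alpha>
        by (simp add: u_def powr_mult powr_powr \<theta>_def qX0 qY0 p0 W0 flip: mult.assoc)
      also have "(qX x * qY y) powr ((1 - \<alpha>) * (1 / \<alpha>)) * (qX x * qY y) powr (1 - 1 / \<alpha>) = 1"
        using q \<alpha> by (simp only: powr_add[symmetric]) (auto simp: field_simps)
      finally show ?thesis by simp
    qed
    then have "pX x * T x \<le> (\<Sum>y\<in>UNIV. u x y powr (1 / \<alpha>) * (qX x * (qY y * r y x)) powr (1 - 1 / \<alpha>))"
      unfolding T_def sum_distrib_left by (rule sum_mono)
    also have "\<dots> \<le> U x powr (1 / \<alpha>) * (\<Sum>y\<in>UNIV. qX x * (qY y * r y x)) powr (1 - 1 / \<alpha>)"
      unfolding U_def by (rule Holder_sum_powr) (use \<alpha> u0 qX0 qY0 r0 in auto)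
    finally show ?thesis by (simp add: \<rho>_def \<theta>_def sum_distrib_left)
  qed
  have "pX x powr \<beta> * T x powr \<beta> \<le> U x powr s * ((qX x * \<rho> x) powr (1 / 2)) powr (1 - s)" for x
  proof -
    have "pX x powr \<beta> * T x powr \<beta> = (pX x * T x) powr \<beta>"
      using p0 T0 by (simp add: powr_mult)
    also have "\<dots> \<le> (U x powr (1 / \<alpha>) * (qX x * \<rho> x) powr \<theta>) powr \<beta>"
      using pT \<beta> p0 T0 by (intro powr_mono2) auto
    also have "\<dots> = U x powr (1 / \<alpha> * \<beta>) * (qX x * \<rho> x) powr (\<theta> * \<beta>)"
      using U0 qX0 \<rho>0 by (simp add: powr_mult powr_powr)
    also have "\<dots> = U x powr s * ((qX x * \<rho> x) powr (1 / 2)) powr (1 - s)"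
      by (simp only: \<beta> powr_powr)
    finally show ?thesis .
  qed
  then have "(\<Sum>x\<in>UNIV. pX x powr \<beta> * T x powr \<beta>)
    \<le> (\<Sum>x\<in>UNIV. U x powr s * ((qX x * \<rho> x) powr (1 / 2)) powr (1 - s))"
    by (rule sum_mono)
  also have "\<dots> \<le> sum U UNIV powr s * (\<Sum>x\<in>UNIV. (qX x * \<rho> x) powr (1 / 2)) powr (1 - s)"
    by (rule Holder_sum_powr) (use \<beta> U0 in auto)
  \<comment> \<open>Cauchy-Schwarz: two distributions have Bhattacharyya coefficient at most
    1.\<close>
  also have "\<dots> \<le> sum U UNIV powr s * 1 powr (1 - s)"
  proof -
    have "(\<Sum>x\<in>UNIV. (qX x * \<rho> x) powr (1 / 2)) = (\<Sum>x\<in>UNIV. qX x powr (1 / 2) * \<rho> x powr (1 - 1 / 2))"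
      using qX0 \<rho>0 by (simp add: powr_mult)
    also have "\<dots> \<le> sum qX UNIV powr (1 / 2) * sum \<rho> UNIV powr (1 - 1 / 2)"
      by (rule Holder_sum_powr) (use qX0 \<rho>0 in auto)
    finally have "(\<Sum>x\<in>UNIV. (qX x * \<rho> x) powr (1 / 2)) \<le> 1"
      by (simp add: is_pmf_sum[OF qX] sum\<rho>)
    then show ?thesis
      using \<beta> by (intro mult_left_mono powr_mono2) (auto intro!: sum_nonneg)
  qed
  finally have le: "(\<Sum>x\<in>UNIV. pX x powr \<beta> * T x powr \<beta>) \<le> LP_sum \<alpha> ?p qX qY powr s"
    by (simp add: sumU)
  have renyi: "renyi \<alpha> ?p (\<lambda>(x, y). qX x * qY y) = ereal (ln (LP_sum \<alpha> ?p qX qY) / (\<alpha> - 1))"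
    by (rule renyi_prod_eq_gt1[OF \<alpha> is_pmf_prod[OF pX W]]) (use False in auto)
  show ?thesis
  proof (cases "(\<Sum>x\<in>UNIV. pX x powr \<beta> * T x powr \<beta>) = 0")
    case True
    then show ?thesis by (simp add: LP_closed_def Let_def T_def \<beta>_def \<theta>_def)
  next
    case neq: False
    then have pos: "0 < (\<Sum>x\<in>UNIV. pX x powr \<beta> * T x powr \<beta>)"
      by (simp add: less_le sum_nonneg)
    then have "ln (\<Sum>x\<in>UNIV. pX x powr \<beta> * T x powr \<beta>) \<le> ln (LP_sum \<alpha> ?p qX qY powr s)"
      using le by (subst ln_le_cancel_iff) auto
    also have "\<dots> = s * ln (LP_sum \<alpha> ?p qX qY)"
      by (simp add: ln_powr)
    finally have "(2 * \<alpha> - 1) / (\<alpha> - 1) * ln (\<Sum>x\<in>UNIV. pX x powr \<beta> * T x powr \<beta>)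
      \<le> (2 * \<alpha> - 1) / (\<alpha> - 1) * (s * ln (LP_sum \<alpha> ?p qX qY))"
      using \<alpha> by (intro mult_left_mono) auto
    also have "\<dots> = ln (LP_sum \<alpha> ?p qX qY) / (\<alpha> - 1)"
      using \<alpha> by (simp add: s_def)
    finally show ?thesis
      unfolding renyi using neq by (simp add: LP_closed_def Let_def T_def \<beta>_def \<theta>_def)
  qed
qed

section \<open>The tilted distribution\<close>

text \<open>The normalised geometric combination of \<open>p\<close> and the product. On its support
  its logarithm is affine in theirs, so the integrands of the functionals simplify.\<close>

definition tilted :: "real \<Rightarrow> ('x::finite \<times> 'y::finite \<Rightarrow> real) \<Rightarrow> ('x \<Rightarrow> real) \<Rightarrow> ('y \<Rightarrow> real)
    \<Rightarrow> 'x \<times> 'y \<Rightarrow> real" where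
  "tilted \<alpha> p qX qY = (\<lambda>(x, y). p (x, y) powr \<alpha> * (qX x * qY y) powr (1 - \<alpha>) / LP_sum \<alpha> p qX qY)"

lemma is_pmf_tilted:
  assumes "0 < LP_sum \<alpha> p qX qY"
  shows "is_pmf (tilted \<alpha> p qX qY)"
proof -
  let ?f = "\<lambda>(x, y). p (x, y) powr \<alpha> * (qX x * qY y) powr (1 - \<alpha>)"
  have S: "sum ?f UNIV = LP_sum \<alpha> p qX qY" by (simp add: LP_sum_def sum_UNIV_prod)
  have "is_pmf (\<lambda>z. ?f z / sum ?f UNIV)"
    by (rule is_pmf_normalize) (use assms S in auto)
  also have "(\<lambda>z. ?f z / sum ?f UNIV) = tilted \<alpha> p qX qY"
    by (auto simp: S tilted_def)
  finally show ?thesis .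
qed

lemma tilted_neq_0D:
  assumes "is_pmf pX" "is_channel W" "is_pmf qX" "is_pmf qY"
    and "tilted \<alpha> (\<lambda>(x, y). pX x * W x y) qX qY (x, y) \<noteq> 0"
  shows "pX x > 0" "W x y > 0" "qX x > 0" "qY y > 0"
  using assms by (auto simp: tilted_def is_channel_def is_pmf_def less_le)

lemma ln_tilted:
  assumes "is_pmf pX" "is_channel W" "is_pmf qX" "is_pmf qY"
    and "tilted \<alpha> (\<lambda>(x, y). pX x * W x y) qX qY (x, y) \<noteq> 0"
    and "0 < LP_sum \<alpha> (\<lambda>(x, y). pX x * W x y) qX qY"
  shows "ln (tilted \<alpha> (\<lambda>(x, y). pX x * W x y) qX qY (x, y)) = \<alpha> * (ln (pX x) + ln (W x y))
    + (1 - \<alpha>) * (ln (qX x) + ln (qY y)) - ln (LP_sum \<alpha> (\<lambda>(x, y). pX x * W x y) qX qY)"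
  using tilted_neq_0D[OF assms(1-5)] assms(6) by (simp add: tilted_def ln_div ln_mult)

text \<open>At the tilted distribution the functional equals the optimal value minus the divergence
  of \<open>m\<close> from \<open>qX\<close>, hence is at most that value; the lower bound for all
  arguments then gives equality.\<close>

lemma I_LP_is_min_F_LP:
  fixes pX :: "'x::finite \<Rightarrow> real" and W :: "'x \<Rightarrow> 'y::finite \<Rightarrow> real"
  assumes \<alpha>: "0 < \<alpha>" "\<alpha> < 1" and pX: "is_pmf pX" and W: "is_channel W"
  shows "is_min_value {(qt, qY). is_pmf qt \<and> is_pmf qY} (\<lambda>(qt, qY). F_LP \<alpha> pX W qt qY) (I_LP \<alpha> pX W)"
proof -
  let ?p = "\<lambda>(x, y). pX x * W x y"
  have lower: "I_LP \<alpha> pX W \<le> F_LP \<alpha> pX W qt qY" if "is_pmf qt" "is_pmf qY" for qt qY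
    by (rule order_trans[OF I_LP_le[OF is_pmf_margX[OF that(1)] that(2)] renyi_le_F_LP[OF \<alpha> pX W that]])
  obtain qX qY where qX: "is_pmf qX" and qY: "is_pmf qY"
    and max: "\<And>qX' qY'. is_pmf qX' \<Longrightarrow> is_pmf qY' \<Longrightarrow> LP_sum \<alpha> ?p qX' qY' \<le> LP_sum \<alpha> ?p qX qY"
    using LP_sum_attains_max[OF \<alpha>(2), of ?p] by blast
  define S where "S = LP_sum \<alpha> ?p qX qY"
  define v where "v = ln S / (\<alpha> - 1)"
  define qt where "qt = tilted \<alpha> ?p qX qY"
  define m where "m = margX qt"
  \<comment> \<open>The uniform pair witnesses that the maximum is positive, so \<open>ln S\<close>
    is meaningful.\<close>
  have "0 < LP_sum \<alpha> ?p (\<lambda>_. 1 / real CARD('x)) (\<lambda>_. 1 / real CARD('y))"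
    by (rule LP_sum_pos[OF is_pmf_prod[OF pX W]]) auto
  also have "\<dots> \<le> S" unfolding S_def by (intro max is_pmf_uniform)
  finally have S: "0 < S" .
  have "ereal v \<le> I_LP \<alpha> pX W"
  proof (rule I_LP_greatest)
    fix qX' :: "'x \<Rightarrow> real" and qY' :: "'y \<Rightarrow> real" assume q': "is_pmf qX'" "is_pmf qY'"
    have "ereal v \<le> ereal (ln (LP_sum \<alpha> ?p qX' qY') / (\<alpha> - 1))" if "LP_sum \<alpha> ?p qX' qY' \<noteq> 0"
    proof -
      have "ln (LP_sum \<alpha> ?p qX' qY') \<le> ln S"
        using that LP_sum_nonneg[of \<alpha> ?p qX' qY'] max[OF q'] S by (simp add: S_def)
      then show ?thesis using \<alpha> by (simp add: v_def divide_right_mono_neg)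
    qed
    then show "ereal v \<le> renyi \<alpha> ?p (\<lambda>(x, y). qX' x * qY' y)"
      by (simp add: renyi_prod_eq_lt1[OF \<alpha>(2)])
  qed
  moreover have "F_LP \<alpha> pX W qt qY \<le> ereal v"
  proof -
    have qt: "is_pmf qt" unfolding qt_def by (rule is_pmf_tilted) (use S in \<open>simp add: S_def\<close>)
    have m: "is_pmf m" unfolding m_def by (rule is_pmf_margX[OF qt])
    have pos: "pX x > 0" "W x y > 0" "qX x > 0" "qY y > 0" "m x > 0" if "qt (x, y) \<noteq> 0" for x y
      using tilted_neq_0D[OF pX W qX qY] margX_pos[OF qt] that unfolding qt_def m_def by blast+
    have "F_LP \<alpha> pX W qt qY = ereal (\<Sum>x\<in>UNIV. \<Sum>y\<in>UNIV. qt (x, y) *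
      (\<alpha> / (1 - \<alpha>) * (ln (qt (x, y)) - ln (pX x) - ln (W x y))
        + ln (qt (x, y)) - ln (m x) - ln (qY y)))"
      unfolding m_def by (rule F_LP_eq[OF qt pX W qY]) (use pos in fastforce)
    also have "\<dots> = ereal (\<Sum>x\<in>UNIV. \<Sum>y\<in>UNIV. qt (x, y) * (v + ln (qX x / m x)))"
    proof (intro arg_cong[of _ _ ereal] sum.cong refl)
      fix x y
      show "qt (x, y) * (\<alpha> / (1 - \<alpha>) * (ln (qt (x, y)) - ln (pX x) - ln (W x y))
        + ln (qt (x, y)) - ln (m x) - ln (qY y)) = qt (x, y) * (v + ln (qX x / m x))"
      proof (cases "qt (x, y) = 0")
        case False
        have "ln (qt (x, y)) = \<alpha> * (ln (pX x) + ln (W x y)) + (1 - \<alpha>) * (ln (qX x) + ln (qY y)) - ln S"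
          unfolding qt_def S_def using False S by (intro ln_tilted[OF pX W qX qY]) (simp_all add: qt_def S_def)
        moreover have "ln (qX x / m x) = ln (qX x) - ln (m x)"
          using pos[OF False] by (simp add: ln_div)
        moreover have "1 - \<alpha> \<noteq> 0" "\<alpha> - 1 = - (1 - \<alpha>)" using \<alpha> by auto
        ultimately show ?thesis
          unfolding v_def by (simp only:) (simp add: field_simps)
      qed simp
    qed
    also have "\<dots> = ereal (\<Sum>x\<in>UNIV. m x * (v + ln (qX x / m x)))"
      by (simp only: m_def sum_margX)
    also have "(\<Sum>x\<in>UNIV. m x * (v + ln (qX x / m x))) = v + (\<Sum>x\<in>UNIV. m x * ln (qX x / m x))"
      by (simp add: distrib_left sum.distrib is_pmf_sum[OF m] flip: sum_distrib_right)
    \<comment> \<open>This is Gibbs' inequality for \<open>m\<close> and \<open>qX\<close>.\<close>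
    also have "(\<Sum>x\<in>UNIV. m x * ln (qX x / m x)) \<le> sum m UNIV * ln (sum qX UNIV / sum m UNIV)"
    proof (rule log_sum_inequality)
      show "qX x \<noteq> 0" if "m x \<noteq> 0" for x
        using margX_neq_0D[of qt x] that pos(3) unfolding m_def by (metis less_irrefl)
    qed (use is_pmfD[OF m] is_pmfD[OF qX] in auto)
    also have "\<dots> = 0" by (simp add: is_pmf_sum[OF m] is_pmf_sum[OF qX])
    finally show ?thesis by simp
  qed
  moreover have "is_pmf qt" unfolding qt_def by (rule is_pmf_tilted) (use S in \<open>simp add: S_def\<close>)
  ultimately have "I_LP \<alpha> pX W = F_LP \<alpha> pX W qt qY"
    using lower[of qt qY] qY by (meson order_trans antisym)
  then show ?thesis
    using lower \<open>is_pmf qt\<close> qY unfolding is_min_value_def by (auto intro!: image_eqI[of _ _ "(qt, qY)"])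
qed

text \<open>The tilted distribution of an optimal pair has marginals \<open>qX\<close> and
  \<open>qY\<close>. With its reverse channel as \<open>r\<close>, the integrand of the functional
  is the constant \<open>v\<close>, the optimal divergence.\<close>

lemma LP_gt1_saddle:
  assumes \<alpha>: "1 < \<alpha>" and pX: "is_pmf pX" and W: "is_channel W"
  obtains qt r where "is_pmf qt" "is_channel r" "I_LP \<alpha> pX W \<le> Ft_LP \<alpha> pX W qt r"
proof -
  let ?p = "\<lambda>(x, y). pX x * W x y"
  have p: "is_pmf ?p" by (rule is_pmf_prod[OF pX W])
  obtain qX qY where qX: "is_pmf qX" and qY: "is_pmf qY"
    and ac: "\<And>x y. ?p (x, y) \<noteq> 0 \<Longrightarrow> qX x \<noteq> 0 \<and> qY y \<noteq> 0"
    and min: "\<And>qX' qY'. is_pmf qX' \<Longrightarrow> is_pmf qY' \<Longrightarrow>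
      (\<And>x y. ?p (x, y) \<noteq> 0 \<Longrightarrow> qX' x \<noteq> 0 \<and> qY' y \<noteq> 0) \<Longrightarrow> LP_sum \<alpha> ?p qX qY \<le> LP_sum \<alpha> ?p qX' qY'"
    using LP_sum_attains_min[OF \<alpha> p] by blast
  define S where "S = LP_sum \<alpha> ?p qX qY"
  define v where "v = ln S / (\<alpha> - 1)"
  define qt where "qt = tilted \<alpha> ?p qX qY"
  \<comment> \<open>Where \<open>qY\<close> vanishes the conditional is undefined; \<open>pX\<close>
    serves as an arbitrary distribution there.\<close>
  define r where "r y x = (if qY y = 0 then pX x else qt (x, y) / qY y)" for x y
  have S: "0 < S" unfolding S_def by (rule LP_sum_pos[OF p ac])
  have qt: "is_pmf qt" unfolding qt_def by (rule is_pmf_tilted) (use S in \<open>simp add: S_def\<close>)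
  have "margX qt x = qX x" for x
  proof -
    have "(\<Sum>y\<in>UNIV. ?p (x, y) powr \<alpha> * (qX x * qY y) powr (1 - \<alpha>)) = S * qX x"
      unfolding S_def by (rule LP_sum_minimizer_marginal[OF \<alpha> p qX qY ac]) (use ac min qY in blast)+
    then show ?thesis
      using S by (simp add: margX_def qt_def tilted_def S_def flip: sum_divide_distrib)
  qed
  then have mX: "margX qt = qX" by auto
  \<comment> \<open>The same stationarity argument with the alphabets exchanged.\<close>
  have mY: "(\<Sum>x\<in>UNIV. qt (x, y)) = qY y" for y
  proof -
    have pmf': "is_pmf (\<lambda>(y, x). ?p (x, y))"
      using p unfolding is_pmf_def sum_UNIV_prod by (subst sum.swap) auto
    have "(\<Sum>x\<in>UNIV. (\<lambda>(y, x). ?p (x, y)) (y, x) powr \<alpha> * (qY y * qX x) powr (1 - \<alpha>))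
      = LP_sum \<alpha> (\<lambda>(y, x). ?p (x, y)) qY qX * qY y"
    proof (rule LP_sum_minimizer_marginal[OF \<alpha> pmf' qY qX])
      show "qY y \<noteq> 0 \<and> qX x \<noteq> 0" if "(\<lambda>(y, x). ?p (x, y)) (y, x) \<noteq> 0" for x y
        using ac[of x y] that by auto
      fix qY' assume "is_pmf qY'" and ac': "\<And>y x. (\<lambda>(y, x). ?p (x, y)) (y, x) \<noteq> 0 \<Longrightarrow> qY' y \<noteq> 0"
      then have "LP_sum \<alpha> ?p qX qY \<le> LP_sum \<alpha> ?p qX qY'"
        using ac by (intro min qX) auto
      then show "LP_sum \<alpha> (\<lambda>(y, x). ?p (x, y)) qY qX \<le> LP_sum \<alpha> (\<lambda>(y, x). ?p (x, y)) qY' qX"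
        by (simp only: LP_sum_swap[of \<alpha> ?p])
    qed
    then have "(\<Sum>x\<in>UNIV. ?p (x, y) powr \<alpha> * (qX x * qY y) powr (1 - \<alpha>)) = S * qY y"
      unfolding LP_sum_swap[of \<alpha> ?p] S_def by (simp add: mult.commute)
    then show ?thesis
      using S by (simp add: qt_def tilted_def S_def flip: sum_divide_distrib)
  qed
  have r: "is_channel r"
    unfolding is_channel_def
  proof
    fix y
    show "is_pmf (r y)"
    proof (cases "qY y = 0")
      case True
      then show ?thesis using pX by (simp add: r_def is_pmf_def)
    next
      case False
      then show ?thesis using is_pmfD[OF qt] is_pmfD[OF qY] mY[of y]
        by (simp add: r_def is_pmf_def flip: sum_divide_distrib)
    qed
  qed
  have pos: "pX x > 0" "W x y > 0" "qX x > 0" "qY y > 0" "qt (x, y) > 0" if "qt (x, y) \<noteq> 0" for x y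
    using tilted_neq_0D[OF pX W qX qY] that is_pmf_nonneg[OF qt, of "(x, y)"] unfolding qt_def by auto
  have "Ft_LP \<alpha> pX W qt r = ereal (\<Sum>x\<in>UNIV. \<Sum>y\<in>UNIV. qt (x, y) *
    (\<alpha> / (1 - \<alpha>) * (ln (qt (x, y)) - ln (pX x) - ln (W x y)) + ln (r y x) - ln (qX x)))"
    unfolding mX[symmetric]
    by (rule Ft_LP_eq[OF qt pX W r]) (use pos in \<open>fastforce simp: r_def\<close>)
  \<comment> \<open>Since \<open>ln (r y x) - ln (qX x)\<close> is \<open>ln (qt (x, y))\<close>
    minus the logarithm of the product, all terms cancel except
    \<open>ln S / (\<alpha> - 1)\<close>.\<close>
  also have "\<dots> = ereal (\<Sum>x\<in>UNIV. \<Sum>y\<in>UNIV. qt (x, y) * v)"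
  proof (intro arg_cong[of _ _ ereal] sum.cong refl)
    fix x y
    show "qt (x, y) * (\<alpha> / (1 - \<alpha>) * (ln (qt (x, y)) - ln (pX x) - ln (W x y))
      + ln (r y x) - ln (qX x)) = qt (x, y) * v"
    proof (cases "qt (x, y) = 0")
      case False
      have "ln (r y x) = ln (qt (x, y)) - ln (qY y)"
        using pos[OF False] by (simp add: r_def ln_div)
      moreover have "ln (qt (x, y)) = \<alpha> * (ln (pX x) + ln (W x y)) + (1 - \<alpha>) * (ln (qX x) + ln (qY y)) - ln S"
        unfolding qt_def S_def using False S by (intro ln_tilted[OF pX W qX qY]) (simp_all add: qt_def S_def)
      moreover have "1 - \<alpha> \<noteq> 0" "\<alpha> - 1 = - (1 - \<alpha>)" using \<alpha> by auto
      ultimately show ?thesis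
        unfolding v_def by (simp only:) (simp add: field_simps)
    qed simp
  qed
  also have "\<dots> = ereal v"
    using is_pmf_sum[OF qt] by (simp add: sum_UNIV_prod flip: sum_distrib_right)
  finally have "Ft_LP \<alpha> pX W qt r = ereal v" .
  moreover have "I_LP \<alpha> pX W \<le> ereal v"
    using I_LP_le[OF qX qY, of \<alpha> pX W] unfolding v_def S_def
    by (subst (asm) renyi_prod_eq_gt1[OF \<alpha> p ac])
  ultimately show thesis using that[OF qt r] by simp
qed

section \<open>From the chain of bounds to attained extrema\<close>

theorem theorem3:
  fixes \<alpha> :: real and pX :: "'x::finite \<Rightarrow> real" and W :: "'x \<Rightarrow> 'y::finite \<Rightarrow> real"
  assumes "0 < \<alpha>" and "\<alpha> \<noteq> 1" and "is_pmf pX" and "is_channel W"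
  shows "(\<alpha> < 1 \<longrightarrow>
            is_min_value {(qt, qY). is_pmf qt \<and> is_pmf qY}
              (\<lambda>(qt, qY). F_LP \<alpha> pX W qt qY) (I_LP \<alpha> pX W))
       \<and> (1 < \<alpha> \<longrightarrow>
            is_max_value {(qt, r). is_pmf qt \<and> is_channel r}
              (\<lambda>(qt, r). Ft_LP \<alpha> pX W qt r) (I_LP \<alpha> pX W)
          \<and> is_max_value {r. is_channel r} (\<lambda>r. LP_closed \<alpha> pX W r) (I_LP \<alpha> pX W))"
proof (intro conjI impI)
  assume "\<alpha> < 1"
  then show "is_min_value {(qt, qY). is_pmf qt \<and> is_pmf qY}
      (\<lambda>(qt, qY). F_LP \<alpha> pX W qt qY) (I_LP \<alpha> pX W)"
    using I_LP_is_min_F_LP assms by blast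
next
  assume \<alpha>: "1 < \<alpha>"
  note Ft_le = Ft_LP_le_LP_closed[OF \<alpha> assms(3,4)]
  have LP_le: "LP_closed \<alpha> pX W r \<le> I_LP \<alpha> pX W" if "is_channel r" for r
    by (intro I_LP_greatest LP_closed_le_renyi[OF \<alpha> assms(3,4) that])
  obtain qt r where q: "is_pmf qt" "is_channel r" and I_le: "I_LP \<alpha> pX W \<le> Ft_LP \<alpha> pX W qt r"
    using LP_gt1_saddle[OF \<alpha> assms(3,4)] .
  \<comment> \<open>The chain of inequalities closes into a cycle at this pair, so one witness
    attains both maxima.\<close>
  have eq: "I_LP \<alpha> pX W = Ft_LP \<alpha> pX W qt r" "I_LP \<alpha> pX W = LP_closed \<alpha> pX W r"
    using I_le Ft_le[OF q] LP_le[OF q(2)] by auto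
  show "is_max_value {(qt, r). is_pmf qt \<and> is_channel r}
      (\<lambda>(qt, r). Ft_LP \<alpha> pX W qt r) (I_LP \<alpha> pX W)"
    unfolding is_max_value_def
  proof (intro conjI ballI)
    show "I_LP \<alpha> pX W \<in> (\<lambda>(qt, r). Ft_LP \<alpha> pX W qt r) ` {(qt, r). is_pmf qt \<and> is_channel r}"
      using q eq(1) by (auto intro!: image_eqI[of _ _ "(qt, r)"])
  next
    fix s :: "('x \<times> 'y \<Rightarrow> real) \<times> ('y \<Rightarrow> 'x \<Rightarrow> real)"
    assume "s \<in> {(qt, r). is_pmf qt \<and> is_channel r}"
    then obtain qt r where s: "s = (qt, r)" "is_pmf qt" "is_channel r" by auto
    then show "(case s of (qt, r) \<Rightarrow> Ft_LP \<alpha> pX W qt r) \<le> I_LP \<alpha> pX W"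
      using order_trans[OF Ft_le[OF s(2,3)] LP_le[OF s(3)]] by simp
  qed
  show "is_max_value {r. is_channel r} (\<lambda>r. LP_closed \<alpha> pX W r) (I_LP \<alpha> pX W)"
    unfolding is_max_value_def using q(2) eq(2) LP_le by auto
qed

end
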